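(* Let $(\mathfrak b,S^i,f^i)$ be a triplet defining a four-dimensional large-$N$ $\mathcal N=2$ quiver SCFT with bifundamental matter (see context), and let $\mathcal U(\mathfrak b)$ be its unfolded (simply-laced, ADE-type) algebra. Then the Hagedorn temperature $T_{\rm Hag}$ of the theory in the large-$N$ and overall free-field limits is uniquely fixed by the Dynkin diagram of $\mathcal U(\mathfrak b)$: $x_{\rm Hag}=e^{-1/T_{\rm Hag}}$ is the smallest $x\in(0,1)$ solving $$1-z_{\rm V}(x)=\lambda_{\max}\,z_{\rm H}(x),\qquad \lambda_{\max}=\begin{cases}2, & \mathcal U(\mathfrak b)\ \text{affine},\\ 2\cos\!\big(\pi/h^\vee_{\mathcal U(\mathfrak b)}\big), & \mathcal U(\mathfrak b)\ \text{finite},\end{cases}$$ where $z_{\rm V}(x)=z_{\rm V}(x,1)$, $z_{\rm H}(x)=z_{\rm H}(x,1)$, $h^\vee_{\mathcal U(\mathfrak b)}$ is the dual Coxeter number of $\mathcal U(\mathfrak b)$, and $\lambda_{\max}$ is the largest eigenvalue of the Cartan adjacency matrix $2\cdot\mathbf 1-C_{\mathcal U(\mathfrak b)}$.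
   Context: **Quiver data.** $\mathfrak b$ is a Lie algebra of finite type $A_r,B_r,C_r,D_r,E_6,E_7,E_8,F_4$ or of affine type $A_r^{(1)},B_r^{(1)},C_r^{(1)},D_r^{(1)},E_{6,7,8}^{(1)},F_4^{(1)},D_{r+1}^{(2)},A_{2r-1}^{(2)},E_6^{(2)}$ (Kac's notation). Nodes $i$ of its Dynkin diagram carry simple gauge algebras $\mathfrak g_i\in\{\mathfrak{su}(k_i),\mathfrak{so}(k_i),\mathfrak{usp}(k_i)\}$ and flavour algebras $\mathfrak f_i$, equal respectively to $\mathfrak{su}(f^i),\mathfrak{usp}(f^i),\mathfrak{so}(f^i)$. Set $S^i=0,-1,+1$ respectively (this is $0,+1,-1$ for flavour $\mathfrak{su},\mathfrak{so},\mathfrak{usp}$), and $d_i=2$ for $\mathfrak{su}$, $d_i=1$ for $\mathfrak{so},\mathfrak{usp}$. If $\mathfrak b$ is simply-laced, either all nodes are $\mathfrak{su}$, or all nodes are $\mathfrak{so}/\mathfrak{usp}$ with adjacent nodes of opposite type. If $\mathfrak b$ is not simply-laced, nodes for long roots have $d_i=1$ (adjacent ones of opposite type), and nodes for short roots have $d_i=2$. Let $D=\mathrm{diag}(d_i)$, let $C$ be the Cartan matrix of $\mathfrak b$ in the convention where $DC$ is symmetric, $A=2\cdot\mathbf 1-C$, and $B=DA$ (the symmetric matrix counting bifundamental half-hypermultiplets). Conformality is the condition $C^{ij}k_j=f^i-4S^i$ with $k_i,f^i$ non-negative integers. **Unfolding.** If $\mathfrak b$ is simply-laced, $\mathcal U(\mathfrak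 b)=\mathfrak b$. Otherwise $\mathcal U(\mathfrak b)$ is the algebra whose Dynkin diagram is obtained by replacing each node with $d_i=2$ by two copies $i_1,i_2$ and keeping single each node with $d_i=1$; two adjacent $d=1$ nodes are joined by one edge; a $d=1$ node adjacent to a $d=2$ node $i$ is joined to both $i_1$ and $i_2$; adjacent $d=2$ nodes $i,j$ give edges $i_1j_1$ and $i_2j_2$. (E.g. $\mathcal U(F_4^{(1)})=E_6^{(1)}$, $\mathcal U(E_6^{(2)})=E_7^{(1)}$.) **Single-letter functions.** $z_\phi(x)=\frac{x(1+x)}{(1-x)^3}$, $z_\psi(x)=\frac{4x^{3/2}}{(1-x)^3}$, $z_A(x)=\frac{6x^2-2x^3}{(1-x)^3}$, and for $n\ge1$ $$z_{\rm V}(x,n)=z_A(x^n)+2z_\phi(x^n)+(-1)^{n+1}2z_\psi(x^n),\qquad z_{\rm H}(x,n)=2z_\phi(x^n)+(-1)^{n+1}z_\psi(x^n).$$ **Large-$N$ free thermal partition function** ($x=e^{-1/T}$, $T$ the temperature). The free partition function on $S^1\times S^3$ is the Haar integral over the gauge group of $$\exp\sum_{n>0}\tfrac1n\Big[z_{\rm V}(x,n)\sum_i\chi_{{\rm adj}_i}(U^n)+\tfrac12z_{\rm H}(x,n)\big(B^{ij}\overline{\chi}_{k_i}(U^n)\chi_{k_j}(U^n)+(D^{ij}\overline{\chi}_{f^i}(V^n)\chi_{k_j}(U^n)+{\rm c.c.})\big)\Big],$$ where $\chi_{k_i}$ is the fundamental gauge character and $\chi_{f^i}(V^n)$ are flavour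 characters, kept as fixed external parameters. In the large-$N$ limit (all $k_i\to\infty$) the power sums $p^{(i)}_n=\chi_{k_i}(U^n)$, $n\ge1$, become independent integration variables (complex if $d_i=2$, real if $d_i=1$), with $$\chi_{{\rm adj}_i}(U^n)=\tfrac{d_i}{2}\big(|p^{(i)}_n|^2+S^ip^{(i)}_{2n}\big)-(d_i-1),$$ and the Haar measure of node $i$ is replaced by $$\prod_{n>0}d^{d_i}p_n^{(i)}\Big(\frac{d_i}{2\pi n}\Big)^{d_i/2}\exp\Big[-\sum_{n>0}\frac{d_i}{2n}\big(|p_n^{(i)}|^2+S^ip_{2n}^{(i)}\big)\Big].$$ The partition function is then a product over $n$ of Gaussian integrals (with linear sources) over the mode-$n$ variables $(p^{(i)}_n)_i$. The Hagedorn point $x_{\rm Hag}=e^{-1/T_{\rm Hag}}$ is the smallest $x\in(0,1)$ at which the Gaussian integral of some mode $n\geq 1$ ceases to converge, i.e. its quadratic form ceases to be positive definite; this is the first singularity of the partition function. *)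

theory Defs
  imports "HOL-Analysis.Analysis" "Jordan_Normal_Form.Char_Poly"
begin

section \<open>Dynkin diagrams\<close>

text \<open>
  \<open>FinX\<close> are the finite types, \<open>AffX r\<close> is $X_r^{(1)}$, and the twisted affine types are
  \<open>TwD r\<close> $= D_{r+1}^{(2)}$, \<open>TwA r\<close> $= A_{2r-1}^{(2)}$ and \<open>TwE6\<close> $= E_6^{(2)}$ (Kac's notation).
\<close>

datatype dynkin =
    FinA nat | FinB nat | FinC nat | FinD nat | FinE6 | FinE7 | FinE8 | FinF4
  | AffA nat | AffB nat | AffC nat | AffD nat | AffE6 | AffE7 | AffE8 | AffF4
  | TwD nat | TwA nat | TwE6

text \<open>Kac's ranges of the rank, in which no diagram occurs twice (in particular $B_2 = C_2$).\<close>

fun valid :: "dynkin \<Rightarrow> bool" where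
  "valid (FinA r) \<longleftrightarrow> 1 \<le> r"
| "valid (FinB r) \<longleftrightarrow> 3 \<le> r"
| "valid (FinC r) \<longleftrightarrow> 2 \<le> r"
| "valid (FinD r) \<longleftrightarrow> 4 \<le> r"
| "valid (AffA r) \<longleftrightarrow> 1 \<le> r"
| "valid (AffB r) \<longleftrightarrow> 3 \<le> r"
| "valid (AffC r) \<longleftrightarrow> 2 \<le> r"
| "valid (AffD r) \<longleftrightarrow> 4 \<le> r"
| "valid (TwD r) \<longleftrightarrow> 2 \<le> r"
| "valid (TwA r) \<longleftrightarrow> 3 \<le> r"
| "valid _ \<longleftrightarrow> True"

fun is_affine :: "dynkin \<Rightarrow> bool" where
  "is_affine (FinA r) \<longleftrightarrow> False"
| "is_affine (FinB r) \<longleftrightarrow> False"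
| "is_affine (FinC r) \<longleftrightarrow> False"
| "is_affine (FinD r) \<longleftrightarrow> False"
| "is_affine FinE6 \<longleftrightarrow> False"
| "is_affine FinE7 \<longleftrightarrow> False"
| "is_affine FinE8 \<longleftrightarrow> False"
| "is_affine FinF4 \<longleftrightarrow> False"
| "is_affine _ \<longleftrightarrow> True"

text \<open>The nodes are \<open>0, \<dots>, num_nodes b - 1\<close>.\<close>

fun num_nodes :: "dynkin \<Rightarrow> nat" where
  "num_nodes (FinA r) = r"
| "num_nodes (FinB r) = r"
| "num_nodes (FinC r) = r"
| "num_nodes (FinD r) = r"
| "num_nodes FinE6 = 6"
| "num_nodes FinE7 = 7"
| "num_nodes FinE8 = 8"
| "num_nodes FinF4 = 4"
| "num_nodes (AffA r) = r + 1"
| "num_nodes (AffB r) = r + 1"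
| "num_nodes (AffC r) = r + 1"
| "num_nodes (AffD r) = r + 1"
| "num_nodes AffE6 = 7"
| "num_nodes AffE7 = 8"
| "num_nodes AffE8 = 9"
| "num_nodes AffF4 = 5"
| "num_nodes (TwD r) = r + 1"
| "num_nodes (TwA r) = r + 1"
| "num_nodes TwE6 = 5"

definition chain :: "nat \<Rightarrow> nat \<Rightarrow> (nat \<times> nat) set" where
  "chain a b = {(i, Suc i) | i. a \<le> i \<and> Suc i \<le> b}"

text \<open>Pairs of adjacent nodes, each listed once and irrespective of the multiplicity of the bond.\<close>

fun bonds :: "dynkin \<Rightarrow> (nat \<times> nat) set" where
  "bonds (FinA r) = chain 0 (r - 1)"
| "bonds (FinB r) = chain 0 (r - 1)"
| "bonds (FinC r) = chain 0 (r - 1)"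
| "bonds (FinD r) = chain 0 (r - 2) \<union> {(r - 3, r - 1)}"
| "bonds FinE6 = chain 0 4 \<union> {(2, 5)}"
| "bonds FinE7 = chain 0 5 \<union> {(2, 6)}"
| "bonds FinE8 = chain 0 6 \<union> {(2, 7)}"
| "bonds FinF4 = chain 0 3"
| "bonds (AffA r) = chain 0 r \<union> {(0, r)}"
| "bonds (AffB r) = chain 1 r \<union> {(0, 2)}"
| "bonds (AffC r) = chain 0 r"
| "bonds (AffD r) = chain 1 (r - 1) \<union> {(0, 2), (r - 2, r)}"
| "bonds AffE6 = chain 0 4 \<union> {(2, 5), (5, 6)}"
| "bonds AffE7 = chain 0 6 \<union> {(3, 7)}"
| "bonds AffE8 = chain 0 7 \<union> {(2, 8)}"
| "bonds AffF4 = chain 0 4"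
| "bonds (TwD r) = chain 0 r"
| "bonds (TwA r) = chain 1 r \<union> {(0, 2)}"
| "bonds TwE6 = chain 0 4"

definition adjacent :: "dynkin \<Rightarrow> nat \<Rightarrow> nat \<Rightarrow> bool" where
  "adjacent b i j \<longleftrightarrow> (i, j) \<in> bonds b \<or> (j, i) \<in> bonds b"

fun short_node :: "dynkin \<Rightarrow> nat \<Rightarrow> bool" where
  "short_node (FinB r) i \<longleftrightarrow> i = r - 1"
| "short_node (FinC r) i \<longleftrightarrow> i < r - 1"
| "short_node FinF4 i \<longleftrightarrow> i = 2 \<or> i = 3"
| "short_node (AffB r) i \<longleftrightarrow> i = r"
| "short_node (AffC r) i \<longleftrightarrow> 0 < i \<and> i < r"
| "short_node AffF4 i \<longleftrightarrow> i = 3 \<or> i = 4"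
| "short_node (TwD r) i \<longleftrightarrow> i = 0 \<or> i = r"
| "short_node (TwA r) i \<longleftrightarrow> i < r"
| "short_node TwE6 i \<longleftrightarrow> i \<le> 2"
| "short_node _ i \<longleftrightarrow> False"

text \<open>All roots have the same length; this includes $A_1^{(1)}$.\<close>

definition simply_laced :: "dynkin \<Rightarrow> bool" where
  "simply_laced b \<longleftrightarrow> (\<forall>i < num_nodes b. \<not> short_node b i)"

text \<open>
  $C^{ij} = 2(\alpha_i,\alpha_j)/(\alpha_j,\alpha_j)$, the transpose of Kac's convention. It is the
  convention in which $DC$ is symmetric for $D$ equal to 1 on long and 2 on short nodes.
\<close>

definition cartan :: "dynkin \<Rightarrow> int mat" where
  "cartan b = Matrix.mat (num_nodes b) (num_nodes b) (\<lambda>(i, j).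
     if i = j then 2
     else if adjacent b i j then
       (if b = AffA 1 \<or> (\<not> short_node b i \<and> short_node b j) then -2 else -1)
     else 0)"

definition adjacency :: "dynkin \<Rightarrow> int mat" where
  "adjacency b = 2 \<cdot>\<^sub>m 1\<^sub>m (num_nodes b) - cartan b"


subsection \<open>The dual Coxeter number\<close>

text \<open>
  As in Kac, the dual Coxeter number of a finite type is the sum of the dual Kac labels of its
  untwisted affine extension, i.e. of the relatively prime positive integers annihilated by
  the transpose of Kac's affine Cartan matrix, which is \<^const>\<open>cartan\<close>.
\<close>

fun affine_extension :: "dynkin \<Rightarrow> dynkin" where
  "affine_extension (FinA r) = AffA r"
| "affine_extension (FinB r) = AffB r"
| "affine_extension (FinC r) = AffC r"
| "affine_extension (FinD r) = AffD r"
| "affine_extension FinE6 = AffE6"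
| "affine_extension FinE7 = AffE7"
| "affine_extension FinE8 = AffE8"
| "affine_extension FinF4 = AffF4"
| "affine_extension b = b"

definition dual_kac_labels :: "dynkin \<Rightarrow> (nat \<Rightarrow> nat) \<Rightarrow> bool" where
  "dual_kac_labels b a \<longleftrightarrow>
     (\<forall>i < num_nodes b. 0 < a i) \<and> Gcd (a ` {..<num_nodes b}) = 1 \<and>
     cartan b *\<^sub>v Matrix.vec (num_nodes b) (\<lambda>i. int (a i)) = 0\<^sub>v (num_nodes b)"

definition dual_coxeter :: "dynkin \<Rightarrow> nat" where
  "dual_coxeter b =
     (THE h. \<exists>a. dual_kac_labels (affine_extension b) a \<and>
                 h = (\<Sum>i < num_nodes (affine_extension b). a i))"


subsection \<open>Unfolding\<close>

text \<open>
  Nodes of the unfolded diagram are pairs (node, copy). Only the short nodes, which are those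
  with $d_i = 2$ when the diagram is not simply-laced, have a second copy.
\<close>

definition unfolded_nodes :: "dynkin \<Rightarrow> (nat \<times> nat) set" where
  "unfolded_nodes b = {(i, c). i < num_nodes b \<and> (c = 0 \<or> c = 1 \<and> short_node b i)}"

definition unfolded_cartan :: "dynkin \<Rightarrow> nat \<times> nat \<Rightarrow> nat \<times> nat \<Rightarrow> int" where
  "unfolded_cartan b = (\<lambda>(i, c) (j, c').
     if simply_laced b then cartan b $$ (i, j)
     else if (i, c) = (j, c') then 2
     else if adjacent b i j \<and> (short_node b i \<and> short_node b j \<longrightarrow> c = c') then -1
     else 0)"

text \<open>\<open>U\<close> is (the type of) the simply-laced algebra $\mathcal U(b)$, the diagram being matched up
  to relabelling of its nodes.\<close>

definition unfolds_to :: "dynkin \<Rightarrow> dynkin \<Rightarrow> bool" where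
  "unfolds_to b U \<longleftrightarrow> valid U \<and> simply_laced U \<and>
     (\<exists>\<pi>. bij_betw \<pi> (unfolded_nodes b) {..<num_nodes U} \<and>
          (\<forall>u \<in> unfolded_nodes b. \<forall>v \<in> unfolded_nodes b.
             unfolded_cartan b u v = cartan U $$ (\<pi> u, \<pi> v)))"


section \<open>Quiver theories\<close>

datatype gauge = SU | SO | USP

fun S_sign :: "gauge \<Rightarrow> int" where
  "S_sign SU = 0" | "S_sign SO = -1" | "S_sign USP = 1"

fun d_factor :: "gauge \<Rightarrow> nat" where
  "d_factor SU = 2" | "d_factor SO = 1" | "d_factor USP = 1"

text \<open>The triplet $(b, S^i, f^i)$; $S^i$ is recorded through the type of gauge algebra, which
  also determines the type of the flavour algebra.\<close>

record quiver =
  alg :: dynkin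
  gauge_at :: "nat \<Rightarrow> gauge"
  flavours :: "nat \<Rightarrow> nat"

abbreviation size_of :: "quiver \<Rightarrow> nat" where "size_of Q \<equiv> num_nodes (alg Q)"
abbreviation S_at :: "quiver \<Rightarrow> nat \<Rightarrow> int" where "S_at Q i \<equiv> S_sign (gauge_at Q i)"
abbreviation d_at :: "quiver \<Rightarrow> nat \<Rightarrow> nat" where "d_at Q i \<equiv> d_factor (gauge_at Q i)"

definition D_mat :: "quiver \<Rightarrow> int mat" where
  "D_mat Q = Matrix.mat (size_of Q) (size_of Q) (\<lambda>(i, j). if i = j then int (d_at Q i) else 0)"

definition B_mat :: "quiver \<Rightarrow> int mat" where
  "B_mat Q = D_mat Q * adjacency (alg Q)"

definition alternating :: "quiver \<Rightarrow> bool" where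
  "alternating Q \<longleftrightarrow> (\<forall>i < size_of Q. \<forall>j < size_of Q.
     adjacent (alg Q) i j \<and> d_at Q i = 1 \<and> d_at Q j = 1 \<longrightarrow> gauge_at Q i \<noteq> gauge_at Q j)"

definition gauge_compatible :: "quiver \<Rightarrow> bool" where
  "gauge_compatible Q \<longleftrightarrow>
     (if simply_laced (alg Q)
      then (\<forall>i < size_of Q. d_at Q i = 2) \<or> ((\<forall>i < size_of Q. d_at Q i = 1) \<and> alternating Q)
      else (\<forall>i < size_of Q. d_at Q i = (if short_node (alg Q) i then 2 else 1)) \<and> alternating Q)"

definition conformal :: "quiver \<Rightarrow> (nat \<Rightarrow> nat) \<Rightarrow> bool" where
  "conformal Q k \<longleftrightarrow>
     cartan (alg Q) *\<^sub>v Matrix.vec (size_of Q) (\<lambda>i. int (k i)) =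
     Matrix.vec (size_of Q) (\<lambda>i. int (flavours Q i) - 4 * S_at Q i)"

definition quiver_scft :: "quiver \<Rightarrow> bool" where
  "quiver_scft Q \<longleftrightarrow> valid (alg Q) \<and> gauge_compatible Q \<and> (\<exists>k. conformal Q k)"


section \<open>The large-N free partition function\<close>

definition z_phi :: "real \<Rightarrow> real" where
  "z_phi x = x * (1 + x) / (1 - x) ^ 3"

definition z_psi :: "real \<Rightarrow> real" where
  "z_psi x = 4 * x powr (3/2) / (1 - x) ^ 3"

definition z_A :: "real \<Rightarrow> real" where
  "z_A x = (6 * x ^ 2 - 2 * x ^ 3) / (1 - x) ^ 3"

definition z_V :: "real \<Rightarrow> nat \<Rightarrow> real" where
  "z_V x n = z_A (x ^ n) + 2 * z_phi (x ^ n) + (-1) ^ (n + 1) * 2 * z_psi (x ^ n)"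

definition z_H :: "real \<Rightarrow> nat \<Rightarrow> real" where
  "z_H x n = 2 * z_phi (x ^ n) + (-1) ^ (n + 1) * z_psi (x ^ n)"

text \<open>
  Below, \<open>P i n\<close> is the power sum $p_n^{(i)}$ and \<open>V i n\<close> is the flavour character
  $\chi_{f^i}(V^n)$. The latter are external parameters and may be arbitrary complex numbers.
\<close>

definition chi_adj :: "quiver \<Rightarrow> (nat \<Rightarrow> nat \<Rightarrow> complex) \<Rightarrow> nat \<Rightarrow> nat \<Rightarrow> complex" where
  "chi_adj Q P i n =
     of_nat (d_at Q i) / 2 * (of_real ((cmod (P i n))\<^sup>2) + of_int (S_at Q i) * P i (2 * n))
     - (of_nat (d_at Q i) - 1)"

definition letter_term ::
  "quiver \<Rightarrow> (nat \<Rightarrow> nat \<Rightarrow> complex) \<Rightarrow> real \<Rightarrow> (nat \<Rightarrow> nat \<Rightarrow> complex) \<Rightarrow> nat \<Rightarrow> complex" where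
  "letter_term Q V x P n =
     (let flav = (\<Sum>i < size_of Q. \<Sum>j < size_of Q.
                    of_int (D_mat Q $$ (i, j)) * cnj (V i n) * P j n)
      in 1 / of_nat n *
         (of_real (z_V x n) * (\<Sum>i < size_of Q. chi_adj Q P i n)
          + 1 / 2 * of_real (z_H x n) *
            ((\<Sum>i < size_of Q. \<Sum>j < size_of Q. of_int (B_mat Q $$ (i, j)) * cnj (P i n) * P j n)
             + (flav + cnj flav))))"

definition haar_term :: "quiver \<Rightarrow> (nat \<Rightarrow> nat \<Rightarrow> complex) \<Rightarrow> nat \<Rightarrow> complex" where
  "haar_term Q P n = - (\<Sum>i < size_of Q. of_nat (d_at Q i) / (2 * of_nat n) *
     (of_real ((cmod (P i n))\<^sup>2) + of_int (S_at Q i) * P i (2 * n)))"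

definition exponent_term ::
  "quiver \<Rightarrow> (nat \<Rightarrow> nat \<Rightarrow> complex) \<Rightarrow> real \<Rightarrow> (nat \<Rightarrow> nat \<Rightarrow> complex) \<Rightarrow> nat \<Rightarrow> complex" where
  "exponent_term Q V x P n = letter_term Q V x P n + haar_term Q P n"

text \<open>
  The total exponent, the sum over \<open>m > 0\<close> of \<^const>\<open>exponent_term\<close>, contains no products of
  variables of different modes. Its dependence on the mode-\<open>n\<close> variables \<open>p\<close> is therefore obtained
  by switching off all the others; the terms with \<open>m > n\<close> do not contain \<open>p\<close>, while the one with
  \<open>2 * m = n\<close> contributes a linear source.
\<close>

definition mode_only :: "nat \<Rightarrow> (nat \<Rightarrow> complex) \<Rightarrow> nat \<Rightarrow> nat \<Rightarrow> complex" where
  "mode_only n p = (\<lambda>i m. if m = n then p i else 0)"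

definition mode_exponent ::
  "quiver \<Rightarrow> (nat \<Rightarrow> nat \<Rightarrow> complex) \<Rightarrow> real \<Rightarrow> nat \<Rightarrow> (nat \<Rightarrow> complex) \<Rightarrow> complex" where
  "mode_exponent Q V x n p =
     (\<Sum>m = 1..n. exponent_term Q V x (mode_only n p) m - exponent_term Q V x (\<lambda>_ _. 0) m)"

definition mode_integrand ::
  "quiver \<Rightarrow> (nat \<Rightarrow> nat \<Rightarrow> complex) \<Rightarrow> real \<Rightarrow> nat \<Rightarrow> (nat \<Rightarrow> complex) \<Rightarrow> complex" where
  "mode_integrand Q V x n p =
     of_real (\<Prod>i < size_of Q. (real (d_at Q i) / (2 * pi * real n)) powr (real (d_at Q i) / 2))
     * exp (mode_exponent Q V x n p)"

text \<open>The measure $\prod_i d^{d_i}p^{(i)}$: Lebesgue measure on the complex plane for $d_i = 2$, and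
  on the real line inside it for $d_i = 1$.\<close>

definition mode_measure :: "quiver \<Rightarrow> (nat \<Rightarrow> complex) measure" where
  "mode_measure Q = PiM {..<size_of Q}
     (\<lambda>i. if d_at Q i = 2 then lborel else distr lborel borel complex_of_real)"

definition mode_converges ::
  "quiver \<Rightarrow> (nat \<Rightarrow> nat \<Rightarrow> complex) \<Rightarrow> real \<Rightarrow> nat \<Rightarrow> bool" where
  "mode_converges Q V x n \<longleftrightarrow> integrable (mode_measure Q) (mode_integrand Q V x n)"

definition smallest_in :: "real set \<Rightarrow> real \<Rightarrow> bool" where
  "smallest_in X x \<longleftrightarrow> x \<in> X \<and> (\<forall>y \<in> X. x \<le> y)"

definition hagedorn_point :: "quiver \<Rightarrow> (nat \<Rightarrow> nat \<Rightarrow> complex) \<Rightarrow> real \<Rightarrow> bool" where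
  "hagedorn_point Q V x \<longleftrightarrow>
     smallest_in {y. 0 < y \<and> y < 1 \<and> (\<exists>n \<ge> 1. \<not> mode_converges Q V y n)} x"

definition hagedorn_temperature :: "quiver \<Rightarrow> (nat \<Rightarrow> nat \<Rightarrow> complex) \<Rightarrow> real \<Rightarrow> bool" where
  "hagedorn_temperature Q V T \<longleftrightarrow> 0 < T \<and> hagedorn_point Q V (exp (- 1 / T))"

end

(* A positive vector v with A v = lam v, where A = 2 - C, plays the role of a ground state: since
   D A is symmetric with nonnegative entries, lam * sum d_i |p_i|^2 - sum B_ij p_i p_j is a sum of
   squares vanishing at v. So lam is the top eigenvalue, and the Gaussian of mode n converges iff
   z_V(x,n) + lam z_H(x,n) < 1. Such vectors are explicit for the ADE diagrams (dual Kac labels,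
   resp. sines of multiples of pi/h), and adding up the two copies of each doubled node transports
   them from the unfolded diagram to b without changing lam. As z_V(x,n) + lam z_H(x,n) is at most
   its value for mode 1 at x^n and the latter increases with x, mode 1 is the first to diverge. *)

theory Submission
  imports Defs "HOL-Probability.Distributions"
begin

section \<open>Perron vectors of Dynkin diagrams\<close>

text \<open>No diagonalisation or determinant of the Gaussian enters. Convergence follows by
  domination with a product of one-variable Gaussians; divergence follows from invariance of the
  measure under translations along \<open>v\<close>. Since \<open>v\<close> is real, it is an
  admissible direction at every node, whether the power sum there is real or complex. Equality
  \<open>z_V x n + lam * z_H x n = 1\<close> has to count as divergence although \<open>v\<close> is
  then only a flat direction: otherwise the set of divergent points would be open at its left end
  and have no smallest element. The signs S^i, the flavour characters and the mixing of modes n and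
  2n supply only linear sources, which neither create nor cure a divergence; so the answer depends
  on the diagram alone. The dual Coxeter number is defined by a definite description, so the dual
  Kac labels must be shown unique. The sum of squares serves here a second time: for another
  positive eigenvector with the same \<open>lam\<close> it vanishes, hence the quotient of the two
  vectors is constant along bonds.\<close>

lemma ground_state_identity:
  fixes M :: "nat \<Rightarrow> nat \<Rightarrow> real" and p :: "nat \<Rightarrow> 'a::real_inner"
  assumes sym: "\<And>i j. i < N \<Longrightarrow> j < N \<Longrightarrow> M i j = M j i"
    and pos: "\<And>i. i < N \<Longrightarrow> 0 < v i"
    and eig: "\<And>i. i < N \<Longrightarrow> (\<Sum>j<N. M i j * v j) = lam * d i * v i"
  shows "(\<Sum>i<N. \<Sum>j<N. M i j * v i * v j * (norm (p i /\<^sub>R v i - p j /\<^sub>R v j))\<^sup>2) =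
    2 * (lam * (\<Sum>i<N. d i * (norm (p i))\<^sup>2) - (\<Sum>i<N. \<Sum>j<N. M i j * inner (p i) (p j)))"
proof -
  \<comment> \<open>Each square expands into \<open>R i j + R j i\<close> minus twice a cross term;
    the row sums of \<open>R\<close> are where the eigenvalue equation turns the weights into
    \<open>lam * d i\<close>.\<close>
  define R where "R = (\<lambda>i j. M i j * v j * (norm (p i))\<^sup>2 / v i)"
  have R: "(\<Sum>i<N. \<Sum>j<N. R i j) = lam * (\<Sum>i<N. d i * (norm (p i))\<^sup>2)"
  proof -
    have "(\<Sum>j<N. R i j) = lam * (d i * (norm (p i))\<^sup>2)" if "i < N" for i
    proof -
      have "(\<Sum>j<N. R i j) = (\<Sum>j<N. M i j * v j) * ((norm (p i))\<^sup>2 / v i)"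
        by (simp add: R_def sum_distrib_right sum_divide_distrib)
      then show ?thesis using eig[OF that] pos[OF that] by (simp add: field_simps)
    qed
    then show ?thesis by (simp add: sum_distrib_left)
  qed
  have *: "M i j * v i * v j * (norm (p i /\<^sub>R v i - p j /\<^sub>R v j))\<^sup>2 =
      R i j + R j i - 2 * (M i j * inner (p i) (p j))" if "i < N" "j < N" for i j
    using pos[OF that(1)] pos[OF that(2)] sym[OF that]
    by (simp add: R_def power2_norm_eq_inner inner_diff inner_commute[of "p j" "p i"] field_simps)
  have "(\<Sum>i<N. \<Sum>j<N. M i j * v i * v j * (norm (p i /\<^sub>R v i - p j /\<^sub>R v j))\<^sup>2) =
      (\<Sum>i<N. \<Sum>j<N. R i j) + (\<Sum>i<N. \<Sum>j<N. R j i) - 2 * (\<Sum>i<N. \<Sum>j<N. M i j * inner (p i) (p j))"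
    by (simp add: * sum.distrib sum_subtractf sum_distrib_left)
  also have "(\<Sum>i<N. \<Sum>j<N. R j i) = (\<Sum>i<N. \<Sum>j<N. R i j)"
    by (rule sum.swap)
  finally show ?thesis by (simp add: R)
qed

text \<open>The generality covers two uses: real vectors with unit weights for the spectrum of the
  adjacency matrix, and complex power sums with weights d_i for the Gaussian.\<close>

corollary form_le_ground_state:
  fixes M :: "nat \<Rightarrow> nat \<Rightarrow> real" and p :: "nat \<Rightarrow> 'a::real_inner"
  assumes "\<And>i j. i < N \<Longrightarrow> j < N \<Longrightarrow> M i j = M j i"
    and "\<And>i j. i < N \<Longrightarrow> j < N \<Longrightarrow> 0 \<le> M i j"
    and "\<And>i. i < N \<Longrightarrow> 0 < v i"
    and "\<And>i. i < N \<Longrightarrow> (\<Sum>j<N. M i j * v j) = lam * d i * v i"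
  shows "(\<Sum>i<N. \<Sum>j<N. M i j * inner (p i) (p j)) \<le> lam * (\<Sum>i<N. d i * (norm (p i))\<^sup>2)"
proof -
  have "0 \<le> (\<Sum>i<N. \<Sum>j<N. M i j * v i * v j * (norm (p i /\<^sub>R v i - p j /\<^sub>R v j))\<^sup>2)"
    using assms(2,3) by (intro sum_nonneg mult_nonneg_nonneg) (auto simp: less_imp_le)
  then show ?thesis
    using ground_state_identity[OF assms(1,3,4), of p] by simp
qed

definition adj :: "dynkin \<Rightarrow> nat \<Rightarrow> nat \<Rightarrow> real" where
  "adj b i j = real_of_int (adjacency b $$ (i, j))"

definition perron_vector :: "dynkin \<Rightarrow> real \<Rightarrow> (nat \<Rightarrow> real) \<Rightarrow> bool" where
  "perron_vector b lam v \<longleftrightarrow>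
     (\<forall>i < num_nodes b. 0 < v i \<and> (\<Sum>j < num_nodes b. adj b i j * v j) = lam * v i)"

lemma adjacent_sym: "adjacent b i j \<longleftrightarrow> adjacent b j i"
  by (auto simp: adjacent_def)

lemma adj_eq:
  assumes "i < num_nodes b" "j < num_nodes b"
  shows "adj b i j = (if i \<noteq> j \<and> adjacent b i j
    then (if b = AffA 1 \<or> (\<not> short_node b i \<and> short_node b j) then 2 else 1) else 0)"
  using assms by (auto simp: adj_def adjacency_def cartan_def)

lemma adj_nonneg: "i < num_nodes b \<Longrightarrow> j < num_nodes b \<Longrightarrow> 0 \<le> adj b i j"
  by (simp add: adj_eq)

lemma simply_laced_adj_sym:
  assumes "simply_laced b" "i < num_nodes b" "j < num_nodes b"
  shows "adj b i j = adj b j i"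
  using assms by (auto simp: adj_eq simply_laced_def adjacent_sym[of b j i])

lemma dim_adjacency [simp]: "dim_row (adjacency b) = num_nodes b" "dim_col (adjacency b) = num_nodes b"
  by (simp_all add: adjacency_def cartan_def)

lemma mult_vec_adjacency:
  assumes "i < num_nodes b" "u \<in> carrier_vec (num_nodes b)"
  shows "vec_index (map_mat real_of_int (adjacency b) *\<^sub>v u) i = (\<Sum>j < num_nodes b. adj b i j * vec_index u j)"
proof -
  have "dim_vec u = num_nodes b" using assms by auto
  then show ?thesis
    using assms(1) by (simp add: scalar_prod_def adj_def lessThan_atLeast0)
qed

lemma num_nodes_pos: "valid b \<Longrightarrow> 0 < num_nodes b"
  by (cases b) auto

lemma perron_vector_eigenvalue:
  assumes "perron_vector b lam v" "valid b"
  shows "eigenvalue (map_mat real_of_int (adjacency b)) lam"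
proof -
  let ?u = "Matrix.vec (num_nodes b) v"
  have "?u \<noteq> 0\<^sub>v (num_nodes b)"
  proof
    assume "?u = 0\<^sub>v (num_nodes b)"
    then have "vec_index ?u 0 = vec_index (0\<^sub>v (num_nodes b)) 0" by simp
    then show False using assms num_nodes_pos[of b] by (auto simp: perron_vector_def)
  qed
  moreover have "map_mat real_of_int (adjacency b) *\<^sub>v ?u = lam \<cdot>\<^sub>v ?u"
  proof (rule eq_vecI)
    fix i assume "i < dim_vec (lam \<cdot>\<^sub>v ?u)"
    then show "vec_index (map_mat real_of_int (adjacency b) *\<^sub>v ?u) i = vec_index (lam \<cdot>\<^sub>v ?u) i"
      using assms by (subst mult_vec_adjacency) (auto simp: perron_vector_def)
  qed auto
  ultimately show ?thesis
    unfolding eigenvalue_def eigenvector_def by (intro exI[of _ ?u]) simp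
qed

text \<open>Rayleigh quotient: on an eigenvector the form equals \<mu> times a positive squared
  norm, while the ground state bounds it by \<open>lam\<close> times the same norm.\<close>

lemma perron_vector_eigenvalue_le:
  assumes "perron_vector b lam v" "simply_laced b"
    and "eigenvalue (map_mat real_of_int (adjacency b)) \<mu>"
  shows "\<mu> \<le> lam"
proof -
  let ?N = "num_nodes b"
  obtain u where u: "u \<in> carrier_vec ?N" "u \<noteq> 0\<^sub>v ?N"
      and eq: "map_mat real_of_int (adjacency b) *\<^sub>v u = \<mu> \<cdot>\<^sub>v u"
    using assms(3) by (auto simp: eigenvalue_def eigenvector_def)
  have row: "(\<Sum>j<?N. adj b i j * vec_index u j) = \<mu> * vec_index u i" if "i < ?N" for i
    using arg_cong[OF eq, of "\<lambda>w. vec_index w i"] mult_vec_adjacency[OF that u(1)] u(1) that by simp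
  have "\<mu> * (\<Sum>i<?N. (vec_index u i)\<^sup>2) = (\<Sum>i<?N. \<mu> * (vec_index u i)\<^sup>2)"
    by (rule sum_distrib_left)
  also have "\<dots> = (\<Sum>i<?N. vec_index u i * (\<Sum>j<?N. adj b i j * vec_index u j))"
    by (intro sum.cong) (auto simp: row power2_eq_square)
  also have "\<dots> = (\<Sum>i<?N. \<Sum>j<?N. adj b i j * inner (vec_index u i) (vec_index u j))"
    by (simp add: sum_distrib_left mult_ac)
  also have "\<dots> \<le> lam * (\<Sum>i<?N. 1 * (norm (vec_index u i))\<^sup>2)"
  proof (rule form_le_ground_state[where v = v])
    show "adj b i j = adj b j i" if "i < ?N" "j < ?N" for i j
      using simply_laced_adj_sym[OF assms(2) that] .
  qed (use assms(1) in \<open>auto simp: adj_nonneg perron_vector_def\<close>)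
  finally have "\<mu> * (\<Sum>i<?N. (vec_index u i)\<^sup>2) \<le> lam * (\<Sum>i<?N. (vec_index u i)\<^sup>2)" by simp
  moreover have "0 < (\<Sum>i<?N. (vec_index u i)\<^sup>2)"
  proof -
    obtain i where "i < ?N" "vec_index u i \<noteq> 0" using u by (metis carrier_vecD eq_vecI index_zero_vec)
    then show ?thesis by (intro sum_pos2[of _ i]) auto
  qed
  ultimately show ?thesis by simp
qed

section \<open>Uniqueness of the dual Kac labels\<close>

lemma kernel_cartan_iff:
  fixes a :: "nat \<Rightarrow> nat"
  shows "cartan b *\<^sub>v Matrix.vec (num_nodes b) (\<lambda>i. int (a i)) = 0\<^sub>v (num_nodes b) \<longleftrightarrow>
    (\<forall>i < num_nodes b. (\<Sum>j < num_nodes b. adj b i j * real (a j)) = 2 * real (a i))"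
    (is "?L = 0\<^sub>v ?N \<longleftrightarrow> _")
proof -
  have dim: "dim_row (cartan b) = ?N" "dim_col (cartan b) = ?N"
    by (simp_all add: cartan_def)
  have entry: "real_of_int (vec_index ?L i) = 2 * real (a i) - (\<Sum>j<?N. adj b i j * real (a j))"
    if "i < ?N" for i
  proof -
    have "real_of_int (vec_index ?L i) = (\<Sum>j<?N. real_of_int (cartan b $$ (i, j)) * real (a j))"
      using that by (simp add: scalar_prod_def dim lessThan_atLeast0)
    also have "\<dots> = (\<Sum>j<?N. (if j = i then 2 * real (a j) else 0) - adj b i j * real (a j))"
      using that by (intro sum.cong) (auto simp: adj_def adjacency_def dim algebra_simps)
    finally show ?thesis using that by (simp add: sum_subtractf)
  qed
  define u where "u = ?L"
  have "dim_vec u = ?N" by (simp add: u_def dim)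
  then have "u = 0\<^sub>v ?N \<longleftrightarrow> (\<forall>i<?N. real_of_int (vec_index u i) = 0)"
    by auto
  also have "\<dots> \<longleftrightarrow> (\<forall>i<?N. (\<Sum>j<?N. adj b i j * real (a j)) = 2 * real (a i))"
    using entry by (auto simp flip: u_def)
  finally show ?thesis unfolding u_def .
qed

lemma perron_vector_pos: "perron_vector b lam v \<Longrightarrow> i < num_nodes b \<Longrightarrow> 0 < v i"
  by (simp add: perron_vector_def)

text \<open>With \<open>w\<close> inserted into the sum of squares built on \<open>v\<close>, the
  right-hand side vanishes; all terms are nonnegative, so each square belonging to a bond is
  zero.\<close>

lemma perron_vector_ratio:
  assumes v: "perron_vector b lam v" and w: "perron_vector b lam w" and b: "simply_laced b"
    and ij: "i < num_nodes b" "j < num_nodes b" "adjacent b i j"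
  shows "w i / v i = w j / v j"
proof (cases "i = j")
  case False
  let ?N = "num_nodes b"
  let ?g = "\<lambda>i j. adj b i j * v i * v j * (norm (w i /\<^sub>R v i - w j /\<^sub>R v j))\<^sup>2"
  have vpos: "0 < v k" if "k < ?N" for k using v that by (simp add: perron_vector_def)
  have nonneg: "0 \<le> ?g k l" if "k < ?N" "l < ?N" for k l
    using that by (intro mult_nonneg_nonneg) (auto simp: adj_nonneg vpos less_imp_le)
  have "(\<Sum>k<?N. \<Sum>l<?N. ?g k l) =
      2 * (lam * (\<Sum>k<?N. 1 * (norm (w k))\<^sup>2) - (\<Sum>k<?N. \<Sum>l<?N. adj b k l * inner (w k) (w l)))"
  proof (rule ground_state_identity)
    show "adj b k l = adj b l k" if "k < ?N" "l < ?N" for k l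
      using simply_laced_adj_sym[OF b that] .
  qed (use v in \<open>auto simp: perron_vector_def\<close>)
  also have "(\<Sum>k<?N. \<Sum>l<?N. adj b k l * inner (w k) (w l)) = (\<Sum>k<?N. w k * (\<Sum>l<?N. adj b k l * w l))"
    by (simp add: sum_distrib_left mult_ac)
  also have "\<dots> = lam * (\<Sum>k<?N. 1 * (norm (w k))\<^sup>2)"
    using w unfolding perron_vector_def sum_distrib_left
    by (intro sum.cong) (auto simp: power2_eq_square simp flip: sum_distrib_left)
  finally have "(\<Sum>k<?N. \<Sum>l<?N. ?g k l) = 0" by simp
  then have "(\<Sum>l<?N. ?g i l) = 0"
    using ij nonneg by (subst (asm) sum_nonneg_eq_0_iff) (auto intro!: sum_nonneg)
  then have "?g i j = 0"
    using ij nonneg by (subst (asm) sum_nonneg_eq_0_iff) auto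
  moreover have "0 < adj b i j" using ij False by (simp add: adj_eq)
  ultimately show ?thesis
    using vpos[OF ij(1)] vpos[OF ij(2)] by (simp add: field_simps)
qed simp

text \<open>The label 1 at \<open>k\<close> fixes the scale: every other labelling is
  \<open>c k * a i\<close>, so \<open>c k\<close> divides its gcd, which is 1. Connectedness is
  phrased through functions constant along bonds, because \<open>perron_vector_ratio\<close>
  delivers exactly such a function, the quotient of two labellings.\<close>

lemma dual_coxeter_eqI:
  fixes a :: "nat \<Rightarrow> nat"
  assumes ext: "affine_extension b = U" and lace: "simply_laced U"
    and perron: "perron_vector U 2 (\<lambda>i. real (a i))"
    and k: "k < num_nodes U" "a k = 1"
    and connected: "\<And>f :: nat \<Rightarrow> real.
      (\<And>i j. i < num_nodes U \<Longrightarrow> j < num_nodes U \<Longrightarrow> adjacent U i j \<Longrightarrow> f i = f j) \<Longrightarrow>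
      (\<forall>i < num_nodes U. f i = f k)"
  shows "dual_coxeter b = (\<Sum>i < num_nodes U. a i)"
proof -
  let ?N = "num_nodes U"
  have labels_iff: "dual_kac_labels U c \<longleftrightarrow> Gcd (c ` {..<?N}) = 1 \<and> perron_vector U 2 (\<lambda>i. real (c i))" for c
    by (auto simp: dual_kac_labels_def kernel_cartan_iff perron_vector_def)
  have "Gcd (a ` {..<?N}) dvd a k" using k(1) by (intro Gcd_dvd imageI) simp
  then have labels: "dual_kac_labels U a" using perron k by (simp add: labels_iff)
  have unique: "c i = a i" if c: "dual_kac_labels U c" and i: "i < ?N" for c i
  proof -
    have c': "perron_vector U 2 (\<lambda>i. real (c i))" using c by (simp add: labels_iff)
    have ratio: "\<forall>i<?N. real (c i) / real (a i) = real (c k) / real (a k)"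
      by (rule connected[of "\<lambda>i. real (c i) / real (a i)"]) (rule perron_vector_ratio[OF perron c' lace])
    have "real (c i) = real (c k * a i)" if "i < ?N" for i
    proof -
      have "real (c i) / real (a i) = real (c k) / real (a k)" using ratio that by blast
      then have "real (c i) / real (a i) = real (c k)" using k(2) by simp
      moreover have "0 < real (a i)" using perron_vector_pos[OF perron that] .
      ultimately show ?thesis by (simp add: field_simps)
    qed
    then have proportional: "c i = c k * a i" if "i < ?N" for i
      using that of_nat_eq_iff[where 'a = real] by blast
    then have "c k dvd Gcd (c ` {..<?N})"
      using proportional by (intro Gcd_greatest) (metis dvd_triv_left imageE lessThan_iff)
    then have "c k = 1" using c by (simp add: labels_iff)
    then show ?thesis using proportional[OF i] by simp
  qed
  show ?thesis unfolding dual_coxeter_def ext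
  proof (rule the_equality)
    show "\<exists>c. dual_kac_labels U c \<and> (\<Sum>i<?N. a i) = (\<Sum>i<?N. c i)" using labels by blast
  next
    fix h assume "\<exists>c. dual_kac_labels U c \<and> h = (\<Sum>i<?N. c i)"
    then show "h = (\<Sum>i<?N. a i)" using unique by (metis (no_types, lifting) lessThan_iff sum.cong)
  qed
qed

section \<open>Explicit Perron vectors of the ADE diagrams\<close>

definition nbrs :: "dynkin \<Rightarrow> nat \<Rightarrow> nat set" where
  "nbrs b i = {j. j < num_nodes b \<and> j \<noteq> i \<and> adjacent b i j}"

text \<open>\<open>AffA 1\<close> is excluded because its only bond has weight 2, which a plain sum
  over neighbours would undercount.\<close>

lemma perron_vectorI:
  assumes b: "simply_laced b" "b \<noteq> AffA 1"
    and pos: "\<And>i. i < num_nodes b \<Longrightarrow> 0 < v i"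
    and eig: "\<And>i. i < num_nodes b \<Longrightarrow> (\<Sum>j \<in> nbrs b i. v j) = lam * v i"
  shows "perron_vector b lam v"
proof -
  have "(\<Sum>j < num_nodes b. adj b i j * v j) = (\<Sum>j \<in> nbrs b i. v j)" if "i < num_nodes b" for i
  proof -
    have "(\<Sum>j < num_nodes b. adj b i j * v j) = (\<Sum>j < num_nodes b. if j \<noteq> i \<and> adjacent b i j then v j else 0)"
      using b that by (intro sum.cong) (auto simp: adj_eq simply_laced_def)
    also have "\<dots> = (\<Sum>j \<in> nbrs b i. v j)"
      by (rule sum.mono_neutral_cong_right) (auto simp: nbrs_def)
    finally show ?thesis .
  qed
  then show ?thesis using pos eig by (simp add: perron_vector_def)
qed

lemma chain_iff: "(i, j) \<in> chain a c \<longleftrightarrow> j = Suc i \<and> a \<le> i \<and> j \<le> c"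
  by (auto simp: chain_def)

lemmas nbrs_simps = nbrs_def adjacent_def chain_iff

lemma sin_neighbours: "sin ((real k - 1) * t) + sin ((real k + 1) * t) = 2 * cos t * sin (real k * t)"
  by (simp add: algebra_simps sin_add sin_diff)

lemma sin_multiple_pos:
  assumes "0 < k" "k < n"
  shows "0 < sin (real k * (pi / real n))"
proof (rule sin_gt_zero)
  show "0 < real k * (pi / real n)" using assms by simp
  have "real k / real n < 1" using assms by simp
  then have "pi * (real k / real n) < pi * 1" by (intro mult_strict_left_mono) auto
  then show "real k * (pi / real n) < pi" by (simp add: mult.commute)
qed

lemma perron_FinA:
  assumes "1 \<le> r"
  shows "perron_vector (FinA r) (2 * cos (pi / real (r + 1))) (\<lambda>i. sin (real (i + 1) * (pi / real (r + 1))))"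
proof -
  define t where "t = pi / real (r + 1)"
  define s where "s = (\<lambda>k::nat. sin (real k * t))"
  have rec: "s k + s (k + 2) = 2 * cos t * s (k + 1)" for k
    using sin_neighbours[of "k + 1" t] by (simp add: s_def add_ac)
  have "real (r + 1) * t = pi" by (simp add: t_def)
  \<comment> \<open>The sine vanishes just beyond both ends of the chain, so a missing neighbour may
    be counted as a neighbour with value 0.\<close>
  then have ends: "s 0 = 0" "s (r + 1) = 0" unfolding s_def by simp_all
  have "perron_vector (FinA r) (2 * cos t) (\<lambda>i. s (i + 1))"
  proof (rule perron_vectorI)
    show "simply_laced (FinA r)" by (simp add: simply_laced_def)
    fix i assume i: "i < num_nodes (FinA r)"
    then show "0 < s (i + 1)" unfolding s_def t_def by (intro sin_multiple_pos) auto
    have nb: "nbrs (FinA r) i = (if i = 0 then {} else {i - 1}) \<union> (if Suc i < r then {Suc i} else {})"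
      using i assms by (auto simp: nbrs_simps)
    have "Suc i = r \<or> Suc i < r" using i by auto
    then have "(\<Sum>j \<in> nbrs (FinA r) i. s (j + 1)) = s i + s (i + 2)"
      unfolding nb using ends by (cases i) auto
    then show "(\<Sum>j \<in> nbrs (FinA r) i. s (j + 1)) = 2 * cos t * s (i + 1)"
      using rec[of i] by simp
  qed simp
  then show ?thesis by (simp add: s_def t_def)
qed

lemma perron_AffA: "1 \<le> r \<Longrightarrow> perron_vector (AffA r) 2 (\<lambda>i. 1)"
proof (cases "r = 1")
  case True
  have "{..<Suc (Suc 0)} = {0, 1}" by auto
  then show ?thesis using True by (auto simp: perron_vector_def adj_eq nbrs_simps less_Suc_eq)
next
  case False
  assume "1 \<le> r"
  show ?thesis
  proof (rule perron_vectorI)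
    show "simply_laced (AffA r)" by (simp add: simply_laced_def)
    fix i assume i: "i < num_nodes (AffA r)"
    have nb: "nbrs (AffA r) i = {if i = 0 then r else i - 1, if i = r then 0 else Suc i}"
      using i False \<open>1 \<le> r\<close> by (auto simp: nbrs_simps)
    have ne: "(if i = 0 then r else i - 1) \<noteq> (if i = r then 0 else Suc i)"
      using False \<open>1 \<le> r\<close> by auto
    show "(\<Sum>j\<in>nbrs (AffA r) i. 1) = 2 * (1::real)" unfolding nb using ne by simp
  qed (use False in auto)
qed

lemma perron_FinD:
  assumes "4 \<le> r"
  shows "\<exists>v. perron_vector (FinD r) (2 * cos (pi / real (2 * r - 2))) v"
proof -
  define m where "m = r - 3"
  then have r: "r = m + 3" and m: "1 \<le> m" using assms by auto
  define t where "t = pi / real (2 * m + 4)"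
  define s where "s = (\<lambda>k::nat. sin (real k * t))"
  \<comment> \<open>This is twice the sine vector of the chain with \<open>2 * m + 3\<close> nodes,
    cut at its middle \<open>k = m + 2\<close>. The middle value 2 is split evenly between the two
    fork ends, where the eigenvalue equation becomes \<open>s (m + 1) = cos t\<close>.\<close>
  define v where "v = (\<lambda>i. if i \<le> m then 2 * s (i + 1) else 1)"
  have s_pos: "0 < s k" if "0 < k" "k < 2 * m + 4" for k
    using sin_multiple_pos[OF that] by (simp add: s_def t_def)
  have half: "real (m + 2) * t = pi / 2" by (simp add: t_def field_simps)
  then have top: "s (m + 2) = 1" unfolding s_def half by simp
  have rec: "s k + s (k + 2) = 2 * cos t * s (k + 1)" for k
    using sin_neighbours[of "k + 1" t] by (simp add: s_def add_ac)
  have s0: "s 0 = 0" by (simp add: s_def)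
  have "real (m + 1) * t = pi / 2 - t" using half by (simp add: algebra_simps)
  then have reflect: "s (m + 1) = cos t" unfolding s_def by (simp add: sin_diff)
  have "perron_vector (FinD r) (2 * cos t) v"
  proof (rule perron_vectorI)
    show "simply_laced (FinD r)" by (simp add: simply_laced_def)
    fix i assume "i < num_nodes (FinD r)"
    then have i: "i < m + 3" by (simp add: r)
    show "0 < v i" using s_pos[of "i + 1"] by (auto simp: v_def)
    consider "i = 0" | "0 < i" "i < m" | "i = m" | "i = m + 1" | "i = m + 2" using i by linarith
    then show "(\<Sum>j\<in>nbrs (FinD r) i. v j) = 2 * cos t * v i"
    proof cases
      case 1
      then have "nbrs (FinD r) i = {1}" using m by (auto simp: r nbrs_simps)
      then show ?thesis using 1 m rec[of 0] by (simp add: v_def s0)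
    next
      case 2
      then have "nbrs (FinD r) i = {i - 1, i + 1}" by (auto simp: r nbrs_simps)
      moreover have "v (i - 1) = 2 * s i" "v (i + 1) = 2 * s (i + 2)" "v i = 2 * s (i + 1)" "i - 1 \<noteq> i + 1"
        using 2 by (auto simp: v_def)
      ultimately show ?thesis using rec[of i] by simp
    next
      case 3
      then have "nbrs (FinD r) i = {m - 1, m + 1, m + 2}" using m by (auto simp: r nbrs_simps)
      moreover have "v (m - 1) = 2 * s m" "v (m + 1) = 1" "v (m + 2) = 1" "v i = 2 * s (m + 1)"
        "m - 1 \<noteq> m + 1" "m - 1 \<noteq> m + 2"
        using 3 m by (auto simp: v_def)
      ultimately show ?thesis using rec[of m] top by simp
    next
      case 4
      then have "nbrs (FinD r) i = {m}" by (auto simp: r nbrs_simps)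
      then show ?thesis using 4 reflect by (simp add: v_def)
    next
      case 5
      then have "nbrs (FinD r) i = {m}" by (auto simp: r nbrs_simps)
      then show ?thesis using 5 reflect by (simp add: v_def)
    qed
  qed simp
  moreover have "2 * r - 2 = 2 * m + 4" by (simp add: r)
  ultimately show ?thesis by (auto simp: t_def)
qed

definition labels_D :: "nat \<Rightarrow> nat \<Rightarrow> nat" where
  "labels_D r i = (if i \<le> 1 \<or> r - 1 \<le> i then 1 else 2)"

lemma perron_AffD:
  assumes "4 \<le> r"
  shows "perron_vector (AffD r) 2 (\<lambda>i. real (labels_D r i))"
proof -
  define m where "m = r - 4"
  then have r: "r = m + 4" using assms by auto
  show ?thesis
  proof (rule perron_vectorI)
    show "simply_laced (AffD r)" by (simp add: simply_laced_def)
    fix i assume "i < num_nodes (AffD r)"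
    then have i: "i < m + 5" by (simp add: r)
    show "0 < real (labels_D r i)" by (simp add: labels_D_def)
    \<comment> \<open>For \<open>m = 0\<close> the two branch nodes coincide and the centre of
      D_4^(1) has four neighbours.\<close>
    consider "i \<le> 1" | "m + 3 \<le> i" | "i = 2" "m = 0" | "i = 2" "0 < m" | "i = m + 2" "0 < m" | "2 < i" "i < m + 2"
      using i by linarith
    then show "(\<Sum>j\<in>nbrs (AffD r) i. real (labels_D r j)) = 2 * real (labels_D r i)"
    proof cases
      case 1
      then have "nbrs (AffD r) i = {2}" by (auto simp: r nbrs_simps)
      then show ?thesis using 1 by (simp add: labels_D_def r)
    next
      case 2
      then have "nbrs (AffD r) i = {m + 2}" using i by (auto simp: r nbrs_simps)
      then show ?thesis using 2 by (simp add: labels_D_def r)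
    next
      case 3
      then have "nbrs (AffD r) i = {0, 1, 3, 4}" by (auto simp: r nbrs_simps)
      then show ?thesis using 3 by (simp add: labels_D_def r)
    next
      case 4
      then have "nbrs (AffD r) i = {0, 1, 3}" by (auto simp: r nbrs_simps)
      then show ?thesis using 4 by (simp add: labels_D_def r)
    next
      case 5
      then have "nbrs (AffD r) i = {m + 1, m + 3, m + 4}" by (auto simp: r nbrs_simps)
      then show ?thesis using 5 by (simp add: labels_D_def r)
    next
      case 6
      then have "nbrs (AffD r) i = {i - 1, i + 1}" by (auto simp: r nbrs_simps)
      then show ?thesis using 6 by (auto simp: labels_D_def r)
    qed
  qed simp
qed

text \<open>Listing the entries reduces the eigenvalue equation of an exceptional diagram to
  finitely many identities that the simplifier can enumerate.\<close>

lemma perron_vectorI_list: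
  assumes "simply_laced b" "b \<noteq> AffA 1" "length xs = num_nodes b"
    and pos: "\<forall>x \<in> set xs. 0 < x"
    and eig: "\<forall>i < num_nodes b.
      (\<Sum>j < num_nodes b. if j \<noteq> i \<and> adjacent b i j then xs ! j else 0) = lam * xs ! i"
  shows "perron_vector b lam ((!) xs)"
proof (rule perron_vectorI)
  fix i assume i: "i < num_nodes b"
  then show "0 < xs ! i" using assms(3) pos by simp
  have "(\<Sum>j \<in> nbrs b i. xs ! j) = (\<Sum>j < num_nodes b. if j \<noteq> i \<and> adjacent b i j then xs ! j else 0)"
    by (rule sum.mono_neutral_cong_left) (auto simp: nbrs_def)
  then show "(\<Sum>j \<in> nbrs b i. xs ! j) = lam * xs ! i" using eig i by simp
qed fact+

lemma perron_AffE6: "perron_vector AffE6 2 ((!) [1, 2, 3, 2, 1, 2, 1])"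
  by (rule perron_vectorI_list)
    (simp_all add: simply_laced_def eval_nat_numeral All_less_Suc lessThan_Suc adjacent_def chain_iff)

lemma perron_AffE7: "perron_vector AffE7 2 ((!) [1, 2, 3, 4, 3, 2, 1, 2])"
  by (rule perron_vectorI_list)
    (simp_all add: simply_laced_def eval_nat_numeral All_less_Suc lessThan_Suc adjacent_def chain_iff)

lemma perron_AffE8: "perron_vector AffE8 2 ((!) [2, 4, 6, 5, 4, 3, 2, 1, 3])"
  by (rule perron_vectorI_list)
    (simp_all add: simply_laced_def eval_nat_numeral All_less_Suc lessThan_Suc adjacent_def chain_iff)

text \<open>
  On each arm of a branched diagram a Perron vector for \<open>l = 2 cos t\<close> is proportional to
  \<open>sin (k t)\<close>, with \<open>k\<close> counted from the free end. Divided by \<open>sin t\<close> these are the polynomials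
  \<open>1, l, l\<^sup>2 - 1, l\<^sup>3 - 2 l, l\<^sup>4 - 3 l\<^sup>2 + 1\<close>, and the branch node turns into an equation for \<open>l\<close>.
\<close>

lemma sin_quotients:
  assumes "5 < n"
  defines "t \<equiv> pi / real n" and "l \<equiv> 2 * cos (pi / real n)"
  shows "0 < l" "0 < l\<^sup>2 - 1" "0 < l ^ 3 - 2 * l" "0 < l ^ 4 - 3 * l\<^sup>2 + 1"
proof -
  define s where "s = (\<lambda>k::nat. sin (real k * t))"
  have rec: "s (k + 2) = l * s (k + 1) - s k" for k
    using sin_neighbours[of "k + 1" t] by (simp add: s_def l_def t_def add_ac)
  have pos: "0 < s k" if "0 < k" "k < n" for k
    using sin_multiple_pos[OF that] by (simp add: s_def t_def)
  have s0: "s 0 = 0" by (simp add: s_def)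
  have recs: "s 2 = l * s 1 - s 0" "s 3 = l * s 2 - s 1" "s 4 = l * s 3 - s 2" "s 5 = l * s 4 - s 3"
    using rec[of 0] rec[of 1] rec[of 2] rec[of 3] by (simp_all add: eval_nat_numeral)
  have s2: "s 2 = s 1 * l" unfolding recs(1) s0 by simp
  have s3: "s 3 = s 1 * (l\<^sup>2 - 1)"
    unfolding recs(2) s2 by (simp add: algebra_simps eval_nat_numeral)
  have s4: "s 4 = s 1 * (l ^ 3 - 2 * l)"
    unfolding recs(3) s2 s3 by (simp add: algebra_simps eval_nat_numeral)
  have s5: "s 5 = s 1 * (l ^ 4 - 3 * l\<^sup>2 + 1)"
    unfolding recs(4) s3 s4 by (simp add: algebra_simps eval_nat_numeral)
  have s1: "0 < s 1" using pos[of 1] assms(1) by simp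
  show "0 < l" using pos[of 2] s1 assms(1) by (simp add: s2 zero_less_mult_iff)
  show "0 < l\<^sup>2 - 1" using pos[of 3] s1 assms(1) by (simp add: s3 zero_less_mult_iff)
  show "0 < l ^ 3 - 2 * l" using pos[of 4] s1 assms(1) by (simp add: s4 zero_less_mult_iff)
  show "0 < l ^ 4 - 3 * l\<^sup>2 + 1" using pos[of 5] s1 assms(1) by (simp add: s5 zero_less_mult_iff)
qed

lemma two_cos_double: "2 * cos (2 * t) = (2 * cos t)\<^sup>2 - (2::real)"
  using cos_double_cos[of t] by (simp add: power2_eq_square)

lemma two_cos_triple: "2 * cos (3 * t) = (2 * cos t) ^ 3 - 3 * (2 * cos (t::real))"
  using cos_treble_cos[of t] by (simp add: power3_eq_cube)

lemma perron_FinE6: "\<exists>v. perron_vector FinE6 (2 * cos (pi / 12)) v"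
proof -
  define l where "l = 2 * cos (pi / 12)"
  define u3 where "u3 = l\<^sup>2 - 1"
  have pos: "0 < l" "0 < u3" using sin_quotients[of 12] by (simp_all add: l_def u3_def)
  have "l\<^sup>2 - 2 = sqrt 3" using two_cos_double[of "pi / 12"] by (simp add: l_def cos_30)
  then have "(l\<^sup>2 - 2)\<^sup>2 = 3" by simp
  moreover have "l ^ 4 - 4 * l\<^sup>2 + 1 = (l\<^sup>2 - 2)\<^sup>2 - 3"
    by (simp add: algebra_simps eval_nat_numeral)
  ultimately have root: "l ^ 4 - 4 * l\<^sup>2 + 1 = 0" by simp
  \<comment> \<open>The arms have lengths 2, 2, 1 and the sequences \<open>1, l, u3\<close> and
    \<open>1, l\<close> when continued to the branch node. Scaling them by \<open>l\<close>,
    \<open>l\<close> and \<open>u3\<close> makes the values there agree at \<open>l * u3\<close>.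
    The equation at the branch node is then \<open>root\<close>.\<close>
  have "perron_vector FinE6 l ((!) [l, l * l, l * u3, l * l, l, u3])"
  proof (rule perron_vectorI_list)
    have "l * (l * u3) - (l * l + l * l + u3) = l ^ 4 - 4 * l\<^sup>2 + 1"
      unfolding u3_def by (simp add: algebra_simps eval_nat_numeral)
    then have centre: "l * l + l * l + u3 = l * (l * u3)" using root by simp
    have arm: "l + l * u3 = l * (l * l)" unfolding u3_def by (simp add: algebra_simps eval_nat_numeral)
    show "\<forall>i < num_nodes FinE6. (\<Sum>j < num_nodes FinE6. if j \<noteq> i \<and> adjacent FinE6 i j
        then [l, l * l, l * u3, l * l, l, u3] ! j else 0) = l * [l, l * l, l * u3, l * l, l, u3] ! i"
      using centre arm
      by (simp add: eval_nat_numeral All_less_Suc lessThan_Suc adjacent_def chain_iff algebra_simps)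
  qed (use pos in \<open>simp_all add: simply_laced_def\<close>)
  then show ?thesis unfolding l_def by blast
qed

lemma perron_FinE7: "\<exists>v. perron_vector FinE7 (2 * cos (pi / 18)) v"
proof -
  define l where "l = 2 * cos (pi / 18)"
  define u3 u4 where "u3 = l\<^sup>2 - 1" and "u4 = l ^ 3 - 2 * l"
  have pos: "0 < l" "0 < u3" "0 < u4" using sin_quotients[of 18] by (simp_all add: l_def u3_def u4_def)
  have "l ^ 3 - 3 * l = sqrt 3" using two_cos_triple[of "pi / 18"] by (simp add: l_def cos_30)
  then have "(l ^ 3 - 3 * l)\<^sup>2 = 3" by simp
  moreover have "l ^ 6 - 6 * l ^ 4 + 9 * l\<^sup>2 - 3 = (l ^ 3 - 3 * l)\<^sup>2 - 3"
    by (simp add: algebra_simps eval_nat_numeral)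
  ultimately have root: "l ^ 6 - 6 * l ^ 4 + 9 * l\<^sup>2 - 3 = 0" by simp
  \<comment> \<open>Arms of lengths 2, 3, 1 scaled by \<open>l * u4\<close>, \<open>l * u3\<close>
    and \<open>u3 * u4\<close>, with common branch value \<open>l * u3 * u4\<close>.\<close>
  let ?xs = "[l * u4, l * l * u4, l * u3 * u4, l * u3 * u3, l * l * u3, l * u3, u3 * u4]"
  have "perron_vector FinE7 l ((!) ?xs)"
  proof (rule perron_vectorI_list)
    have "l * (l * u3 * u4) - (l * l * u4 + l * u3 * u3 + u3 * u4) =
        l * (l ^ 6 - 6 * l ^ 4 + 9 * l\<^sup>2 - 3)"
      unfolding u3_def u4_def by (simp add: algebra_simps eval_nat_numeral)
    then have centre: "l * l * u4 + l * u3 * u3 + u3 * u4 = l * (l * u3 * u4)" using root by simp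
    have arm: "l * u4 + l * u3 * u4 = l * (l * l * u4)" "l * u3 + l * u3 * u3 = l * (l * l * u3)"
      "l * u3 * u4 + l * l * u3 = l * (l * u3 * u3)"
      unfolding u3_def u4_def by (simp_all add: algebra_simps eval_nat_numeral)
    show "\<forall>i < num_nodes FinE7. (\<Sum>j < num_nodes FinE7. if j \<noteq> i \<and> adjacent FinE7 i j
        then ?xs ! j else 0) = l * ?xs ! i"
      using centre arm
      by (simp add: eval_nat_numeral All_less_Suc lessThan_Suc adjacent_def chain_iff algebra_simps)
  qed (use pos in \<open>simp_all add: simply_laced_def\<close>)
  then show ?thesis unfolding l_def by blast
qed

text \<open>At 36 degrees the triple and the double angle add up to pi, so their cosines are
  opposite. This gives a cubic for the cosine c; the factor \<open>c + 1\<close> drops out since c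
  is positive, and the remaining quadratic is the claim.\<close>

lemma cos_36_minus_cos_72: "2 * cos (pi / 5) - 2 * cos (2 * (pi / 5)) = (1::real)"
proof -
  let ?c = "cos (pi / 5)"
  have "cos (3 * (pi / 5)) = - cos (2 * (pi / 5))"
    using cos_minus_pi[of "2 * (pi / 5)"] by (simp add: cos_pi_minus[symmetric] algebra_simps)
  then have "4 * ?c ^ 3 - 3 * ?c = - (2 * ?c\<^sup>2 - 1)"
    unfolding cos_treble_cos[of "pi / 5"] cos_double_cos[of "pi / 5"] .
  then have "(?c + 1) * (4 * ?c\<^sup>2 - 2 * ?c - 1) = 0"
    by (simp add: algebra_simps eval_nat_numeral)
  moreover have "0 < ?c" by (rule cos_gt_zero) auto
  ultimately have "4 * ?c\<^sup>2 - 2 * ?c - 1 = 0" by simp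
  then show ?thesis unfolding cos_double_cos[of "pi / 5"] by simp
qed

lemma perron_FinE8: "\<exists>v. perron_vector FinE8 (2 * cos (pi / 30)) v"
proof -
  define l where "l = 2 * cos (pi / 30)"
  define u3 u4 u5 where "u3 = l\<^sup>2 - 1" and "u4 = l ^ 3 - 2 * l" and "u5 = l ^ 4 - 3 * l\<^sup>2 + 1"
  have pos: "0 < l" "0 < u3" "0 < u4" "0 < u5"
    using sin_quotients[of 30] by (simp_all add: l_def u3_def u4_def u5_def)
  define x where "x = 2 * cos (pi / 15)"
  have x: "x = l\<^sup>2 - 2" using two_cos_double[of "pi / 30"] by (simp add: l_def x_def)
  have c2: "2 * cos (2 * (pi / 15)) = x\<^sup>2 - 2" unfolding two_cos_double x_def ..
  have c4: "2 * cos (4 * (pi / 15)) = (x\<^sup>2 - 2)\<^sup>2 - 2"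
    using two_cos_double[of "2 * (pi / 15)"] unfolding c2 by simp
  have c3: "2 * cos (pi / 5) = x ^ 3 - 3 * x"
    using two_cos_triple[of "pi / 15"] by (simp add: x_def)
  \<comment> \<open>48 and 12 degrees are 30 plus and minus 18, so their cosines differ by -2 sin 30
    sin 18 = -cos 72. Combined with \<open>cos_36_minus_cos_72\<close> this yields a quartic
    equation for \<open>x\<close>, which becomes \<open>root\<close> on substituting
    \<open>x = l^2 - 2\<close>.\<close>
  have angles: "4 * (pi / 15) = pi / 6 + pi / 10" "pi / 15 = pi / 6 - pi / 10" by simp_all
  have "cos (4 * (pi / 15)) - cos (pi / 15) = - sin (pi / 10)"
    unfolding angles(1) unfolding angles(2) cos_add cos_diff by (simp add: sin_30)
  also have "sin (pi / 10) = cos (2 * (pi / 5))"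
    using cos_sin_eq[of "2 * (pi / 5)"] by (simp add: field_simps)
  finally have "2 * cos (4 * (pi / 15)) - x + 2 * cos (pi / 5) = 1"
    using cos_36_minus_cos_72 by (simp add: x_def)
  then have "(x\<^sup>2 - 2)\<^sup>2 - 2 - x + (x ^ 3 - 3 * x) = 1" unfolding c4 c3 .
  moreover have "l ^ 8 - 7 * l ^ 6 + 14 * l ^ 4 - 8 * l\<^sup>2 + 1 = (x\<^sup>2 - 2)\<^sup>2 - 2 - x + (x ^ 3 - 3 * x) - 1"
    unfolding x by (simp add: algebra_simps eval_nat_numeral)
  ultimately have root: "l ^ 8 - 7 * l ^ 6 + 14 * l ^ 4 - 8 * l\<^sup>2 + 1 = 0" by simp
  \<comment> \<open>Arms of lengths 2, 4, 1 scaled by \<open>l * u5\<close>, \<open>l * u3\<close>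
    and \<open>u3 * u5\<close>, with common branch value \<open>l * u3 * u5\<close>.\<close>
  let ?xs = "[l * u5, l * l * u5, l * u3 * u5, l * u3 * u4, l * u3 * u3, l * l * u3, l * u3, u3 * u5]"
  have "perron_vector FinE8 l ((!) ?xs)"
  proof (rule perron_vectorI_list)
    have "l * (l * u3 * u5) - (l * l * u5 + l * u3 * u4 + u3 * u5) =
        l ^ 8 - 7 * l ^ 6 + 14 * l ^ 4 - 8 * l\<^sup>2 + 1"
      unfolding u3_def u4_def u5_def by (simp add: algebra_simps eval_nat_numeral)
    then have centre: "l * l * u5 + l * u3 * u4 + u3 * u5 = l * (l * u3 * u5)" using root by simp
    have arm: "l * u5 + l * u3 * u5 = l * (l * l * u5)" "l * u3 + l * u3 * u3 = l * (l * l * u3)"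
      "l * l * u3 + l * u3 * u4 = l * (l * u3 * u3)" "l * u3 * u5 + l * u3 * u3 = l * (l * u3 * u4)"
      unfolding u3_def u4_def u5_def by (simp_all add: algebra_simps eval_nat_numeral)
    show "\<forall>i < num_nodes FinE8. (\<Sum>j < num_nodes FinE8. if j \<noteq> i \<and> adjacent FinE8 i j
        then ?xs ! j else 0) = l * ?xs ! i"
      using centre arm
      by (simp add: eval_nat_numeral All_less_Suc lessThan_Suc adjacent_def chain_iff algebra_simps)
  qed (use pos in \<open>simp_all add: simply_laced_def\<close>)
  then show ?thesis unfolding l_def by blast
qed

section \<open>Dual Coxeter numbers of the ADE types\<close>

lemma constant_on_chain:
  assumes "\<And>i. a \<le> i \<Longrightarrow> Suc i \<le> c \<Longrightarrow> f i = f (Suc i)" "a \<le> j" "j \<le> c"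
  shows "f j = f a"
  using assms(2,3)
proof (induction j rule: dec_induct)
  case (step k)
  then show ?case using assms(1)[of k] by simp
qed simp

lemma perron_vector_nat_list:
  assumes "perron_vector b lam ((!) (map real xs))" "length xs = num_nodes b"
  shows "perron_vector b lam (\<lambda>i. real (xs ! i))"
  using assms by (simp add: perron_vector_def)

lemma dual_coxeter_FinA:
  assumes "1 \<le> r"
  shows "dual_coxeter (FinA r) = r + 1"
proof -
  have "dual_coxeter (FinA r) = (\<Sum>i < num_nodes (AffA r). 1)"
  proof (rule dual_coxeter_eqI)
    show "perron_vector (AffA r) 2 (\<lambda>i. real 1)" using perron_AffA[OF assms] by simp
    fix f :: "nat \<Rightarrow> real"
    assume f: "\<And>i j. i < num_nodes (AffA r) \<Longrightarrow> j < num_nodes (AffA r) \<Longrightarrow> adjacent (AffA r) i j \<Longrightarrow> f i = f j"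
    have step: "f i = f (Suc i)" if "0 \<le> i" "Suc i \<le> r" for i
      using that by (intro f) (auto simp: nbrs_simps)
    show "\<forall>i < num_nodes (AffA r). f i = f 0"
      by (intro allI impI constant_on_chain[of 0 r f, OF step]) auto
  qed (auto simp: simply_laced_def)
  then show ?thesis by simp
qed

lemma sum_labels_D:
  assumes "4 \<le> r"
  shows "(\<Sum>i < r + 1. labels_D r i) = 2 * r - 2"
proof -
  define m where "m = r - 4"
  then have r: "r = m + 4" using assms by simp
  have "{..<r + 1} = {0, 1, m + 3, m + 4} \<union> {2..<m + 3}" by (auto simp: r)
  then have "(\<Sum>i < r + 1. labels_D r i) =
      (\<Sum>i \<in> {0, 1, m + 3, m + 4}. labels_D r i) + (\<Sum>i \<in> {2..<m + 3}. labels_D r i)"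
    by (simp only:) (rule sum.union_disjoint; auto)
  also have "(\<Sum>i \<in> {2..<m + 3}. labels_D r i) = (\<Sum>i \<in> {2..<m + 3}. 2)"
    by (intro sum.cong) (auto simp: labels_D_def r)
  finally show ?thesis by (simp add: labels_D_def r)
qed

lemma dual_coxeter_FinD:
  assumes "4 \<le> r"
  shows "dual_coxeter (FinD r) = 2 * r - 2"
proof -
  have "dual_coxeter (FinD r) = (\<Sum>i < num_nodes (AffD r). labels_D r i)"
  proof (rule dual_coxeter_eqI)
    show "perron_vector (AffD r) 2 (\<lambda>i. real (labels_D r i))" using perron_AffD[OF assms] .
    show "1 < num_nodes (AffD r)" using assms by simp
    fix f :: "nat \<Rightarrow> real"
    assume f: "\<And>i j. i < num_nodes (AffD r) \<Longrightarrow> j < num_nodes (AffD r) \<Longrightarrow> adjacent (AffD r) i j \<Longrightarrow> f i = f j"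
    have step: "f i = f (Suc i)" if "1 \<le> i" "Suc i \<le> r - 1" for i
      using that by (intro f) (auto simp: nbrs_simps)
    have chain: "f i = f 1" if "1 \<le> i" "i \<le> r - 1" for i
      using constant_on_chain[of 1 "r - 1" f, OF step that] .
    have "f 0 = f 2" "f r = f (r - 2)"
      using assms by (intro f; auto simp: nbrs_simps)+
    moreover have "f 2 = f 1" "f (r - 2) = f 1"
      using assms by (intro chain; simp)+
    ultimately have ends: "f 0 = f 1" "f r = f 1" by simp_all
    show "\<forall>i < num_nodes (AffD r). f i = f 1"
    proof (intro allI impI)
      fix i assume "i < num_nodes (AffD r)"
      then consider "i = 0" | "1 \<le> i" "i \<le> r - 1" | "i = r" by fastforce
      then show "f i = f 1" using ends chain[of i] by cases auto
    qed
  qed (auto simp: simply_laced_def labels_D_def)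
  then show ?thesis using sum_labels_D[OF assms] by simp
qed

lemma dual_coxeter_FinE6: "dual_coxeter FinE6 = 12"
proof -
  have "dual_coxeter FinE6 = (\<Sum>i < num_nodes AffE6. [1, 2, 3, 2, 1, 2, 1] ! i)"
  proof (rule dual_coxeter_eqI)
    show "perron_vector AffE6 2 (\<lambda>i. real ([1, 2, 3, 2, 1, 2, 1] ! i))"
      using perron_AffE6 by (intro perron_vector_nat_list) simp_all
    fix f :: "nat \<Rightarrow> real"
    assume f: "\<And>i j. i < num_nodes AffE6 \<Longrightarrow> j < num_nodes AffE6 \<Longrightarrow> adjacent AffE6 i j \<Longrightarrow> f i = f j"
    have "f 0 = f 1" "f 1 = f 2" "f 2 = f 3" "f 3 = f 4" "f 2 = f 5" "f 5 = f 6"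
      by (intro f; simp add: adjacent_def chain_iff)+
    then show "\<forall>i < num_nodes AffE6. f i = f 0"
      by (simp add: eval_nat_numeral All_less_Suc)
  qed (auto simp: simply_laced_def)
  then show ?thesis by (simp add: eval_nat_numeral)
qed

lemma dual_coxeter_FinE7: "dual_coxeter FinE7 = 18"
proof -
  have "dual_coxeter FinE7 = (\<Sum>i < num_nodes AffE7. [1, 2, 3, 4, 3, 2, 1, 2] ! i)"
  proof (rule dual_coxeter_eqI)
    show "perron_vector AffE7 2 (\<lambda>i. real ([1, 2, 3, 4, 3, 2, 1, 2] ! i))"
      using perron_AffE7 by (intro perron_vector_nat_list) simp_all
    fix f :: "nat \<Rightarrow> real"
    assume f: "\<And>i j. i < num_nodes AffE7 \<Longrightarrow> j < num_nodes AffE7 \<Longrightarrow> adjacent AffE7 i j \<Longrightarrow> f i = f j"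
    have "f 0 = f 1" "f 1 = f 2" "f 2 = f 3" "f 3 = f 4" "f 4 = f 5" "f 5 = f 6" "f 3 = f 7"
      by (intro f; simp add: adjacent_def chain_iff)+
    then show "\<forall>i < num_nodes AffE7. f i = f 0"
      by (simp add: eval_nat_numeral All_less_Suc)
  qed (auto simp: simply_laced_def)
  then show ?thesis by (simp add: eval_nat_numeral)
qed

lemma dual_coxeter_FinE8: "dual_coxeter FinE8 = 30"
proof -
  have "dual_coxeter FinE8 = (\<Sum>i < num_nodes AffE8. [2, 4, 6, 5, 4, 3, 2, 1, 3] ! i)"
  proof (rule dual_coxeter_eqI)
    show "perron_vector AffE8 2 (\<lambda>i. real ([2, 4, 6, 5, 4, 3, 2, 1, 3] ! i))"
      using perron_AffE8 by (intro perron_vector_nat_list) simp_all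
    \<comment> \<open>Node 7 is the only one with label 1, so the scale has to be fixed
      there.\<close>
    show "7 < num_nodes AffE8" by simp
    fix f :: "nat \<Rightarrow> real"
    assume f: "\<And>i j. i < num_nodes AffE8 \<Longrightarrow> j < num_nodes AffE8 \<Longrightarrow> adjacent AffE8 i j \<Longrightarrow> f i = f j"
    have "f 0 = f 1" "f 1 = f 2" "f 2 = f 3" "f 3 = f 4" "f 4 = f 5" "f 5 = f 6" "f 6 = f 7" "f 2 = f 8"
      by (intro f; simp add: adjacent_def chain_iff)+
    then show "\<forall>i < num_nodes AffE8. f i = f 7"
      by (simp add: eval_nat_numeral All_less_Suc)
  qed (auto simp: simply_laced_def)
  then show ?thesis by (simp add: eval_nat_numeral)
qed

section \<open>The largest eigenvalue for every simply-laced type\<close>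

lemma simply_laced_cases:
  assumes "valid b" "simply_laced b"
  shows "(\<exists>r. b = FinA r \<or> b = FinD r \<or> b = AffA r \<or> b = AffD r) \<or>
    b \<in> {FinE6, FinE7, FinE8, AffE6, AffE7, AffE8}"
proof -
  have no_short: "\<not> (i < num_nodes b \<and> short_node b i)" for i
    using assms(2) by (auto simp: simply_laced_def)
  show ?thesis
  proof (cases b)
    case (FinB r) then show ?thesis using no_short[of "r - 1"] assms(1) by simp
  next
    case (FinC r) then show ?thesis using no_short[of 0] assms(1) by simp
  next
    case FinF4 then show ?thesis using no_short[of 2] by simp
  next
    case (AffB r) then show ?thesis using no_short[of r] by simp
  next
    case (AffC r) then show ?thesis using no_short[of 1] assms(1) by simp
  next
    case AffF4 then show ?thesis using no_short[of 3] by simp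
  next
    case (TwD r) then show ?thesis using no_short[of 0] by simp
  next
    case (TwA r) then show ?thesis using no_short[of 0] assms(1) by simp
  next
    case TwE6 then show ?thesis using no_short[of 0] by simp
  qed auto
qed

definition lambda_max :: "dynkin \<Rightarrow> real" where
  "lambda_max U = (if is_affine U then 2 else 2 * cos (pi / real (dual_coxeter U)))"

lemma perron_vector_lambda_max:
  assumes "valid U" "simply_laced U"
  shows "\<exists>v. perron_vector U (lambda_max U) v"
  using simply_laced_cases[OF assms] assms(1)
  using perron_FinA perron_FinD perron_FinE6 perron_FinE7 perron_FinE8
    perron_AffA perron_AffD perron_AffE6 perron_AffE7 perron_AffE8
  by (auto simp: lambda_max_def dual_coxeter_FinA dual_coxeter_FinD
      dual_coxeter_FinE6 dual_coxeter_FinE7 dual_coxeter_FinE8) blast+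

section \<open>Criteria for an unfolding\<close>

lemma unfolds_to_self:
  assumes "valid b" "simply_laced b"
  shows "unfolds_to b b"
proof -
  have nodes: "unfolded_nodes b = {..<num_nodes b} \<times> {0}"
    using assms(2) by (auto simp: unfolded_nodes_def simply_laced_def)
  have "bij_betw fst (unfolded_nodes b) {..<num_nodes b}"
    unfolding nodes by (intro bij_betw_byWitness[where f' = "\<lambda>i. (i, 0)"]) auto
  then show ?thesis
    using assms by (auto simp: unfolds_to_def nodes unfolded_cartan_def intro!: exI[of _ fst])
qed

text \<open>\<open>p\<close> is the relabelling and \<open>q\<close> its inverse. Bonds are stored
  with one orientation, so \<open>down\<close> and \<open>up\<close> speak of stored bonds only and
  symmetry of adjacency supplies the others. The entry -2 of \<open>AffA 1\<close> does not occur
  among the entries 2, -1, 0 of an unfolded diagram with two root lengths.\<close>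

lemma unfolds_toI:
  assumes U: "valid U" "simply_laced U" "U \<noteq> AffA 1" and b: "\<not> simply_laced b"
    and pq: "\<And>i c. (i, c) \<in> unfolded_nodes b \<Longrightarrow> p i c < num_nodes U \<and> q (p i c) = (i, c)"
    and qp: "\<And>k. k < num_nodes U \<Longrightarrow> q k \<in> unfolded_nodes b \<and> case_prod p (q k) = k"
    and down: "\<And>i c j c'. (p i c, p j c') \<in> bonds U \<Longrightarrow>
      (i, c) \<in> unfolded_nodes b \<Longrightarrow> (j, c') \<in> unfolded_nodes b \<Longrightarrow>
      adjacent b i j \<and> (short_node b i \<and> short_node b j \<longrightarrow> c = c')"
    and up: "\<And>i c j c'. (i, j) \<in> bonds b \<Longrightarrow> (short_node b i \<and> short_node b j \<longrightarrow> c = c') \<Longrightarrow>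
      (i, c) \<in> unfolded_nodes b \<Longrightarrow> (j, c') \<in> unfolded_nodes b \<Longrightarrow> adjacent U (p i c) (p j c')"
  shows "unfolds_to b U"
  unfolding unfolds_to_def
proof (intro conjI exI ballI)
  show "bij_betw (case_prod p) (unfolded_nodes b) {..<num_nodes U}"
    using pq qp by (intro bij_betw_byWitness[where f' = q]) auto
  fix u v assume uv: "u \<in> unfolded_nodes b" "v \<in> unfolded_nodes b"
  obtain i c where u: "u = (i, c)" by (cases u)
  obtain j c' where v: "v = (j, c')" by (cases v)
  have nodes: "(i, c) \<in> unfolded_nodes b" "(j, c') \<in> unfolded_nodes b" using uv u v by simp_all
  have bounds: "p i c < num_nodes U" "p j c' < num_nodes U"
    using pq[OF nodes(1)] pq[OF nodes(2)] by simp_all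
  have eq: "p i c = p j c' \<longleftrightarrow> (i, c) = (j, c')"
    using pq[OF nodes(1)] pq[OF nodes(2)] by (metis prod.inject)
  have adj: "adjacent U (p i c) (p j c') \<longleftrightarrow> adjacent b i j \<and> (short_node b i \<and> short_node b j \<longrightarrow> c = c')"
    using down[OF _ nodes] down[OF _ nodes(2,1)] up[OF _ _ nodes] up[OF _ _ nodes(2,1)]
      adjacent_sym[of b i j] adjacent_sym[of U "p i c" "p j c'"]
    unfolding adjacent_def[of U "p i c"] adjacent_def[of b i j] by blast
  have "cartan U $$ (p i c, p j c') =
      (if p i c = p j c' then 2 else if adjacent U (p i c) (p j c') then -1 else 0)"
    using bounds U by (simp add: cartan_def simply_laced_def)
  also have "\<dots> = unfolded_cartan b u v"
    unfolding eq adj using b by (simp add: u v unfolded_cartan_def)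
  finally show "unfolded_cartan b u v = cartan U $$ (case_prod p u, case_prod p v)"
    by (simp add: u v)
qed (use U in auto)

lemma simply_laced_ADE [simp]:
  "simply_laced (FinA r)" "simply_laced (FinD r)" "simply_laced FinE6" "simply_laced FinE7"
  "simply_laced FinE8" "simply_laced (AffA r)" "simply_laced (AffD r)" "simply_laced AffE6"
  "simply_laced AffE7" "simply_laced AffE8"
  by (simp_all add: simply_laced_def)

section \<open>Unfolding\<close>

lemma unfolded_nodes_iff:
  "(i, c) \<in> unfolded_nodes b \<longleftrightarrow> i < num_nodes b \<and> (c = 0 \<or> c = 1 \<and> short_node b i)"
  by (simp add: unfolded_nodes_def)

lemma not_simply_lacedI: "i < num_nodes b \<Longrightarrow> short_node b i \<Longrightarrow> \<not> simply_laced b"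
  by (auto simp: simply_laced_def)

lemmas unfold_simps = unfolded_nodes_iff adjacent_def chain_iff

lemma unfolds_to_FinB: "unfolds_to (FinB (m + 3)) (FinD (m + 4))"
proof (rule unfolds_toI[where p = "\<lambda>i c. if c = 0 then i else m + 3"
      and q = "\<lambda>k. if k = m + 3 then (m + 2, 1) else (k, 0)"])
  show "\<not> simply_laced (FinB (m + 3))" by (intro not_simply_lacedI[of "m + 2"]) auto
qed (auto simp: unfold_simps split: if_splits)

text \<open>The second copy is the mirror image in the long end node \<open>m + 1\<close>, which
  becomes the middle of the chain.\<close>

lemma unfolds_to_FinC: "unfolds_to (FinC (m + 2)) (FinA (2 * m + 3))"
proof (rule unfolds_toI[where p = "\<lambda>i c. if c = 0 then i else 2 * m + 2 - i"
      and q = "\<lambda>k. if k < m + 2 then (k, 0) else (2 * m + 2 - k, 1)"])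
  show "\<not> simply_laced (FinC (m + 2))" by (intro not_simply_lacedI[of "0"]) auto
qed (auto simp: unfold_simps split: if_splits)

lemma unfolds_to_AffB: "unfolds_to (AffB (m + 3)) (AffD (m + 4))"
proof (rule unfolds_toI[where p = "\<lambda>i c. if c = 0 then i else m + 4"
      and q = "\<lambda>k. if k = m + 4 then (m + 3, 1) else (k, 0)"])
  show "\<not> simply_laced (AffB (m + 3))" by (intro not_simply_lacedI[of "m + 3"]) auto
qed (auto simp: unfold_simps split: if_splits)

text \<open>A reflection of the ring; its two fixed points 0 and \<open>m + 2\<close> are the long
  nodes.\<close>

lemma unfolds_to_AffC: "unfolds_to (AffC (m + 2)) (AffA (2 * m + 3))"
proof (rule unfolds_toI[where p = "\<lambda>i c. if c = 0 then i else 2 * m + 4 - i"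
      and q = "\<lambda>k. if k < m + 3 then (k, 0) else (2 * m + 4 - k, 1)"])
  show "\<not> simply_laced (AffC (m + 2))" by (intro not_simply_lacedI[of "1"]) auto
qed (auto simp: unfold_simps split: if_splits)

text \<open>Both ends of the chain split into forks. The copies of node 0 take the labels 0 and 1,
  which shifts the first copies of all later nodes by one.\<close>

lemma unfolds_to_TwD: "unfolds_to (TwD (m + 2)) (AffD (m + 4))"
proof (rule unfolds_toI[where p = "\<lambda>i c. if i = 0 then c else if c = 0 then i + 1 else m + 4"
      and q = "\<lambda>k. if k < 2 then (0, k) else if k = m + 4 then (m + 2, 1) else (k - 1, 0)"])
  show "\<not> simply_laced (TwD (m + 2))" by (intro not_simply_lacedI[of "0"]) auto
qed (auto simp: unfold_simps split: if_splits)

text \<open>Two mirror images are glued at the long node \<open>m + 3\<close>. The reflection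
  reverses the chain bonds of the second copy, so these are matched with stored bonds by
  hand.\<close>

lemma unfolds_to_TwA: "unfolds_to (TwA (m + 3)) (AffD (2 * m + 6))"
proof -
  define p where "p = (\<lambda>i c::nat. if c = 0 then i else 2 * m + 6 - i)"
  define q :: "nat \<Rightarrow> nat \<times> nat" where "q = (\<lambda>k. if k < m + 4 then (k, 0) else (2 * m + 6 - k, 1))"
  show ?thesis
  proof (rule unfolds_toI[where p = p and q = q])
    show "\<not> simply_laced (TwA (m + 3))" by (intro not_simply_lacedI[of "0"]) auto
  next
    fix i c j c'
    assume bond: "(i, j) \<in> bonds (TwA (m + 3))"
      and copy: "short_node (TwA (m + 3)) i \<and> short_node (TwA (m + 3)) j \<longrightarrow> c = c'"
      and nodes: "(i, c) \<in> unfolded_nodes (TwA (m + 3))" "(j, c') \<in> unfolded_nodes (TwA (m + 3))"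
    have c: "c = 0 \<or> c = 1" using nodes(1) by (auto simp: unfold_simps)
    consider "i = 0" "j = 2" "c' = c" | "j = Suc i" "1 \<le> i" "j < m + 3" "c' = c"
      | "i = m + 2" "j = m + 3" "c' = 0"
      using bond copy nodes(2) by (fastforce simp: unfold_simps)
    then show "adjacent (AffD (2 * m + 6)) (p i c) (p j c')"
    proof cases
      case 1
      then show ?thesis using c by (auto simp: p_def unfold_simps)
    next
      case 2
      from c show ?thesis
      proof
        assume "c = 1"
        have "(2 * m + 5 - i, Suc (2 * m + 5 - i)) \<in> bonds (AffD (2 * m + 6))"
          using 2 by (auto simp: chain_iff)
        moreover have "p i c = Suc (2 * m + 5 - i)" "p j c' = 2 * m + 5 - i"
          using 2 \<open>c = 1\<close> by (auto simp: p_def)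
        ultimately show ?thesis unfolding adjacent_def by metis
      qed (use 2 in \<open>simp add: p_def adjacent_def chain_iff\<close>)
    next
      case 3
      then show ?thesis using c by (auto simp: p_def unfold_simps)
    qed
  qed (auto simp: p_def q_def unfold_simps split: if_splits)
qed

text \<open>\<open>xs ! k\<close> is the unfolded node that receives the label \<open>k\<close>; for
  an explicit list all hypotheses are finite checks.\<close>

lemma unfolds_to_listI:
  assumes U: "valid U" "simply_laced U" "U \<noteq> AffA 1" and b: "\<not> simply_laced b"
    and xs: "distinct xs" "length xs = num_nodes U" "set xs = unfolded_nodes b"
    and adj: "\<forall>k < num_nodes U. \<forall>l < num_nodes U. adjacent U k l \<longleftrightarrow>
      adjacent b (fst (xs ! k)) (fst (xs ! l)) \<and>
      (short_node b (fst (xs ! k)) \<and> short_node b (fst (xs ! l)) \<longrightarrow> snd (xs ! k) = snd (xs ! l))"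
  shows "unfolds_to b U"
proof -
  let ?p = "inv_into {..<num_nodes U} ((!) xs)"
  have bij: "bij_betw ((!) xs) {..<num_nodes U} (unfolded_nodes b)"
    using xs by (intro bij_betw_nth) auto
  have p: "?p u < num_nodes U \<and> xs ! ?p u = u" if "u \<in> unfolded_nodes b" for u
    using bij_betw_imp_surj_on[OF bij] that inv_into_into[of u "(!) xs" "{..<num_nodes U}"]
      f_inv_into_f[of u "(!) xs" "{..<num_nodes U}"] by auto
  have adj': "adjacent U (?p (i, c)) (?p (j, c')) \<longleftrightarrow>
      adjacent b i j \<and> (short_node b i \<and> short_node b j \<longrightarrow> c = c')"
    if "(i, c) \<in> unfolded_nodes b" "(j, c') \<in> unfolded_nodes b" for i c j c'
    using adj p[OF that(1)] p[OF that(2)] by auto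
  show ?thesis
  proof (rule unfolds_toI[OF U b, where p = "\<lambda>i c. ?p (i, c)" and q = "(!) xs"])
    show "xs ! k \<in> unfolded_nodes b \<and> (case xs ! k of (i, c) \<Rightarrow> ?p (i, c)) = k"
      if "k < num_nodes U" for k
      using that bij bij_betw_inv_into_left[OF bij, of k] by (auto simp: bij_betw_def)
  next
    fix i c j c' assume nodes: "(i, c) \<in> unfolded_nodes b" "(j, c') \<in> unfolded_nodes b"
    show "adjacent b i j \<and> (short_node b i \<and> short_node b j \<longrightarrow> c = c')"
      if "(?p (i, c), ?p (j, c')) \<in> bonds U"
    proof -
      have "adjacent U (?p (i, c)) (?p (j, c'))" using that by (simp add: adjacent_def)
      then show ?thesis using adj'[OF nodes] by simp
    qed
    show "adjacent U (?p (i, c)) (?p (j, c'))"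
      if "(i, j) \<in> bonds b" "short_node b i \<and> short_node b j \<longrightarrow> c = c'"
    proof -
      have "adjacent b i j" using that(1) by (simp add: adjacent_def)
      then show ?thesis using adj'[OF nodes] that(2) by simp
    qed
  qed (rule p)
qed

lemma unfolds_to_FinF4: "unfolds_to FinF4 FinE6"
proof (rule unfolds_to_listI[where xs = "[(3, 0), (2, 0), (1, 0), (2, 1), (3, 1), (0, 0)]"])
  show "\<not> simply_laced FinF4" by (intro not_simply_lacedI[of "2"]) auto
  show "set [(3, 0), (2, 0), (1, 0), (2, 1), (3, 1), (0, 0)] = unfolded_nodes FinF4"
    by (auto simp: unfolded_nodes_def less_Suc_eq numeral_eq_Suc)
qed (simp_all add: eval_nat_numeral All_less_Suc adjacent_def chain_iff)

lemma unfolds_to_AffF4: "unfolds_to AffF4 AffE6"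
proof (rule unfolds_to_listI[where xs = "[(4, 0), (3, 0), (2, 0), (3, 1), (4, 1), (1, 0), (0, 0)]"])
  show "\<not> simply_laced AffF4" by (intro not_simply_lacedI[of "3"]) auto
  show "set [(4, 0), (3, 0), (2, 0), (3, 1), (4, 1), (1, 0), (0, 0)] = unfolded_nodes AffF4"
    by (auto simp: unfolded_nodes_def less_Suc_eq numeral_eq_Suc)
qed (simp_all add: eval_nat_numeral All_less_Suc adjacent_def chain_iff)

lemma unfolds_to_TwE6: "unfolds_to TwE6 AffE7"
proof (rule unfolds_to_listI[where xs = "[(0, 0), (1, 0), (2, 0), (3, 0), (2, 1), (1, 1), (0, 1), (4, 0)]"])
  show "\<not> simply_laced TwE6" by (intro not_simply_lacedI[of "0"]) auto
  show "set [(0, 0), (1, 0), (2, 0), (3, 0), (2, 1), (1, 1), (0, 1), (4, 0)] = unfolded_nodes TwE6"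
    by (auto simp: unfolded_nodes_def less_Suc_eq numeral_eq_Suc)
qed (simp_all add: eval_nat_numeral All_less_Suc adjacent_def chain_iff)

lemma unfolds_to_exists:
  assumes "valid b"
  shows "\<exists>U. unfolds_to b U"
proof (cases "simply_laced b")
  case True
  then show ?thesis using unfolds_to_self assms by blast
next
  case False
  have offset: "\<exists>m. r = m + k" if "k \<le> r" for k r :: nat
    using that by (metis add.commute le_Suc_ex)
  show ?thesis
  proof (cases b)
    case (FinB r)
    then show ?thesis using offset[of 3 r] unfolds_to_FinB assms by auto
  next
    case (FinC r)
    then show ?thesis using offset[of 2 r] unfolds_to_FinC assms by auto
  next
    case (AffB r)
    then show ?thesis using offset[of 3 r] unfolds_to_AffB assms by auto
  next
    case (AffC r)
    then show ?thesis using offset[of 2 r] unfolds_to_AffC assms by auto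
  next
    case (TwD r)
    then show ?thesis using offset[of 2 r] unfolds_to_TwD assms by auto
  next
    case (TwA r)
    then show ?thesis using offset[of 3 r] unfolds_to_TwA assms by auto
  next
    case FinF4
    then show ?thesis using unfolds_to_FinF4 by blast
  next
    case AffF4
    then show ?thesis using unfolds_to_AffF4 by blast
  next
    case TwE6
    then show ?thesis using unfolds_to_TwE6 by blast
  qed (use False in auto)
qed

text \<open>Adding up the two copies of a node folds a Perron vector of the unfolded diagram.\<close>

lemma perron_vector_fold:
  assumes "unfolds_to b U" "valid b" "perron_vector U lam w"
  shows "\<exists>v. perron_vector b lam v"
proof -
  obtain p where bij: "bij_betw p (unfolded_nodes b) {..<num_nodes U}"
    and C: "\<And>u v. u \<in> unfolded_nodes b \<Longrightarrow> v \<in> unfolded_nodes b \<Longrightarrow>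
      unfolded_cartan b u v = cartan U $$ (p u, p v)"
    using assms(1) by (auto simp: unfolds_to_def)
  let ?N = "num_nodes b"
  define A where "A = (\<lambda>u v. (if u = v then 2 else 0) - real_of_int (unfolded_cartan b u v))"
  have row: "(\<Sum>v \<in> unfolded_nodes b. A u v * w (p v)) = lam * w (p u)" if u: "u \<in> unfolded_nodes b" for u
  proof -
    have pu: "p u < num_nodes U" using bij u by (auto simp: bij_betw_def)
    have "A u v = adj U (p u) (p v)" if v: "v \<in> unfolded_nodes b" for v
    proof -
      have pv: "p v < num_nodes U" using bij v by (auto simp: bij_betw_def)
      have "p u = p v \<longleftrightarrow> u = v" using bij u v by (auto simp: bij_betw_def inj_on_def)
      then show ?thesis using pu pv C[OF u v]
        by (simp add: A_def adj_def adjacency_def cartan_def)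
    qed
    then have "(\<Sum>v \<in> unfolded_nodes b. A u v * w (p v)) = (\<Sum>v \<in> unfolded_nodes b. adj U (p u) (p v) * w (p v))"
      by simp
    also have "\<dots> = (\<Sum>j < num_nodes U. adj U (p u) j * w j)"
      using bij by (rule sum.reindex_bij_betw)
    finally show ?thesis using assms(3) pu by (simp add: perron_vector_def)
  qed
  have pos: "0 < w (p u)" if "u \<in> unfolded_nodes b" for u
    using assms(3) bij that by (auto simp: perron_vector_def bij_betw_def)
  show ?thesis
  proof (cases "simply_laced b")
    case True
    then have nodes: "unfolded_nodes b = (\<lambda>i. (i, 0)) ` {..<?N}"
      by (auto simp: unfolded_nodes_def simply_laced_def)
    have "perron_vector b lam (\<lambda>i. w (p (i, 0)))"
      unfolding perron_vector_def
    proof (intro allI impI conjI)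
      fix i assume i: "i < ?N"
      then show "0 < w (p (i, 0))" by (intro pos) (simp add: unfolded_nodes_iff)
      have "(\<Sum>j<?N. adj b i j * w (p (j, 0))) = (\<Sum>j<?N. A (i, 0) (j, 0) * w (p (j, 0)))"
        using i True by (intro sum.cong) (auto simp: A_def adj_def adjacency_def cartan_def unfolded_cartan_def)
      also have "\<dots> = (\<Sum>v \<in> unfolded_nodes b. A (i, 0) v * w (p v))"
        unfolding nodes by (subst sum.reindex) (auto simp: inj_on_def)
      finally show "(\<Sum>j<?N. adj b i j * w (p (j, 0))) = lam * w (p (i, 0))"
        using row[of "(i, 0)"] i by (simp add: unfolded_nodes_iff)
    qed
    then show ?thesis by blast
  next
    case False
    then have not_A1: "b \<noteq> AffA 1" by (auto simp: simply_laced_def)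
    define s where "s = short_node b"
    define W where "W = (\<lambda>i c. w (p (i, c)))"
    \<comment> \<open>A node with one copy stands for both sheets and counts twice. Its row is
      therefore doubled too, which reproduces the weight 2 that \<open>adj\<close> gives to a bond
      read from a long to a short node.\<close>
    define v where "v = (\<lambda>i. if s i then W i 0 + W i 1 else 2 * W i 0)"
    have nodes: "unfolded_nodes b = Sigma {..<?N} (\<lambda>i. if s i then {0, 1} else {0})"
      by (auto simp: unfolded_nodes_def s_def split: if_splits)
    have split: "(\<Sum>j<?N. A (i, c) (j, 0) * W j 0 + (if s j then A (i, c) (j, 1) * W j 1 else 0)) = lam * W i c"
      if "(i, c) \<in> unfolded_nodes b" for i c
    proof -
      have "(\<Sum>v \<in> unfolded_nodes b. A (i, c) v * w (p v)) =
          (\<Sum>j<?N. \<Sum>c' \<in> (if s j then {0, 1} else {0}). A (i, c) (j, c') * w (p (j, c')))"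
        unfolding nodes by (subst sum.Sigma) (auto simp: case_prod_beta)
      also have "\<dots> = (\<Sum>j<?N. A (i, c) (j, 0) * W j 0 + (if s j then A (i, c) (j, 1) * W j 1 else 0))"
        by (intro sum.cong) (auto simp: W_def)
      finally show ?thesis using row[OF that] by (simp add: W_def)
    qed
    have A: "A (i, c) (j, c') =
        (if i \<noteq> j \<and> adjacent b i j \<and> (s i \<and> s j \<longrightarrow> c = c') then 1 else 0)"
      if "i < ?N" "j < ?N" "\<not> adjacent b i i" for i j c c'
      using that False by (auto simp: A_def unfolded_cartan_def s_def)
    have irrefl: "\<not> adjacent b i i" for i
      using assms(2) by (cases b) (auto simp: adjacent_def chain_iff)
    have "perron_vector b lam v"
      unfolding perron_vector_def
    proof (intro allI impI conjI)
      fix i assume i: "i < ?N"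
      show "0 < v i"
        using i pos[of "(i, 0)"] pos[of "(i, 1)"] by (auto simp: v_def W_def s_def unfolded_nodes_iff)
      show "(\<Sum>j<?N. adj b i j * v j) = lam * v i"
      proof (cases "s i")
        case True
        have "lam * v i = lam * W i 0 + lam * W i 1" using True by (simp add: v_def algebra_simps)
        also have "\<dots> = (\<Sum>j<?N. A (i, 0) (j, 0) * W j 0 + (if s j then A (i, 0) (j, 1) * W j 1 else 0))
            + (\<Sum>j<?N. A (i, 1) (j, 0) * W j 0 + (if s j then A (i, 1) (j, 1) * W j 1 else 0))"
          using i True split[of i 0] split[of i 1] by (simp only: unfolded_nodes_iff s_def simp_thms)
        also have "\<dots> = (\<Sum>j<?N. adj b i j * v j)"
          unfolding sum.distrib[symmetric] using i True not_A1 irrefl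
          by (intro sum.cong) (auto simp: A adj_eq v_def simp flip: s_def)
        finally show ?thesis ..
      next
        case False
        have "lam * v i = 2 * (lam * W i 0)" using False by (simp add: v_def)
        also have "\<dots> = 2 * (\<Sum>j<?N. A (i, 0) (j, 0) * W j 0 + (if s j then A (i, 0) (j, 1) * W j 1 else 0))"
          using i by (simp add: split unfolded_nodes_iff)
        also have "\<dots> = (\<Sum>j<?N. adj b i j * v j)"
          unfolding sum_distrib_left using i False not_A1 irrefl
          by (intro sum.cong) (auto simp: A adj_eq v_def simp flip: s_def)
        finally show ?thesis ..
      qed
    qed
    then show ?thesis by blast
  qed
qed

section \<open>Gaussian integrals over the modes\<close>

lemma integrable_gaussian_real:
  fixes b :: real
  assumes "0 < b"
  shows "integrable lborel (\<lambda>x. exp (- b * x\<^sup>2))"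
proof -
  define \<sigma> where "\<sigma> = sqrt (1 / (2 * b))"
  have "exp (- b * x\<^sup>2) = sqrt (2 * pi * \<sigma>\<^sup>2) * normal_density 0 \<sigma> x" for x
    using assms by (simp add: normal_density_def \<sigma>_def)
  moreover have "0 < \<sigma>" using assms by (simp add: \<sigma>_def)
  ultimately show ?thesis using integrable_normal_density[of \<sigma> 0] by simp
qed

lemma integrable_gaussian_euclidean:
  fixes b :: real
  assumes "0 < b"
  shows "integrable lborel (\<lambda>z::'a::euclidean_space. exp (- b * (norm z)\<^sup>2))"
proof (rule integrableI_nonneg)
  have *: "exp (- b * (norm z)\<^sup>2) = (\<Prod>i\<in>Basis. exp (- b * (inner z i)\<^sup>2))" for z :: 'a
  proof -
    have "(norm z)\<^sup>2 = (\<Sum>i\<in>Basis. (inner z i)\<^sup>2)"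
      unfolding power2_norm_eq_inner euclidean_inner[of z z] by (simp add: power2_eq_square)
    then show ?thesis by (simp add: exp_sum[symmetric] sum_negf sum_distrib_left)
  qed
  have "(\<integral>\<^sup>+z. ennreal (exp (- b * (norm z)\<^sup>2)) \<partial>(lborel :: 'a measure)) =
      (\<integral>\<^sup>+z. (\<Prod>i\<in>Basis. ennreal (exp (- b * (inner z i)\<^sup>2))) \<partial>(lborel :: 'a measure))"
    unfolding * by (simp add: prod_ennreal)
  also have "\<dots> = (\<Prod>i\<in>(Basis::'a set). \<integral>\<^sup>+x. ennreal (exp (- b * x\<^sup>2)) \<partial>lborel)"
    by (rule nn_integral_lborel_prod) auto
  also have "\<dots> < \<infinity>"
    using integrable_gaussian_real[OF assms]
    by (simp add: integrable_iff_bounded power_less_top_ennreal)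
  finally show "(\<integral>\<^sup>+z. ennreal (exp (- b * (norm z)\<^sup>2)) \<partial>(lborel :: 'a measure)) < \<infinity>" .
qed auto

section \<open>The measure of a power sum: translations and Gaussians with a source\<close>

definition power_sum_measure :: "nat \<Rightarrow> complex measure" where
  "power_sum_measure d = (if d = 2 then lborel else distr lborel borel complex_of_real)"

lemma sets_power_sum_measure [simp, measurable_cong]: "sets (power_sum_measure d) = sets borel"
  by (simp add: power_sum_measure_def)

lemma space_power_sum_measure [simp]: "space (power_sum_measure d) = UNIV"
  by (simp add: power_sum_measure_def)

lemma complex_of_real_measurable [measurable]: "complex_of_real \<in> borel_measurable borel"
  by (intro borel_measurable_continuous_onI continuous_intros)

lemma sigma_finite_power_sum_measure: "sigma_finite_measure (power_sum_measure d)"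
proof (cases "d = 2")
  case True
  then show ?thesis by (simp add: power_sum_measure_def lborel.sigma_finite_measure_axioms)
next
  case False
  show ?thesis
  proof
    let ?A = "range (\<lambda>n::nat. cball (0::complex) (real n))"
    have "emeasure (power_sum_measure d) (cball 0 (real n)) \<noteq> \<infinity>" for n
    proof -
      have "complex_of_real -` cball 0 (real n) = {- real n..real n}"
        by (auto simp: abs_le_iff)
      then show ?thesis using False by (simp add: power_sum_measure_def emeasure_distr)
    qed
    moreover have "\<Union>?A = UNIV"
      using real_arch_simple by (auto simp: set_eq_iff)
    ultimately show "\<exists>A. countable A \<and> A \<subseteq> sets (power_sum_measure d) \<and>
        \<Union>A = space (power_sum_measure d) \<and> (\<forall>a\<in>A. emeasure (power_sum_measure d) a \<noteq> \<infinity>)"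
      by (intro exI[of _ ?A]) auto
  qed
qed

text \<open>Only real shifts are considered: an imaginary one would leave the line that carries a
  real power sum.\<close>

lemma power_sum_measure_translate:
  "distr (power_sum_measure d) borel (\<lambda>z. of_real t + z) = power_sum_measure d"
proof (cases "d = 2")
  case True
  then show ?thesis by (simp add: power_sum_measure_def lborel_distr_plus)
next
  case False
  then have "distr (power_sum_measure d) borel (\<lambda>z. of_real t + z) =
      distr (distr lborel borel ((+) t)) borel complex_of_real"
    by (simp add: power_sum_measure_def distr_distr comp_def)
  then show ?thesis using False by (simp add: power_sum_measure_def lborel_distr_plus)
qed

lemma emeasure_power_sum_measure_UNIV: "emeasure (power_sum_measure d) UNIV \<noteq> 0"
  by (simp add: power_sum_measure_def emeasure_distr)

text \<open>By completing the square, \<open>|c| |z| \<le> |c|^2 / (2 a) + (a / 2) |z|^2\<close>;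
  the source costs half of the Gaussian decay and a constant factor \<open>K\<close>.\<close>

lemma integrable_power_sum_gaussian:
  assumes "0 < a"
  shows "integrable (power_sum_measure d) (\<lambda>z. exp (- a * (cmod z)\<^sup>2 + Re (c * z)))"
proof -
  define K where "K = exp ((cmod c)\<^sup>2 / (2 * a))"
  define g where "g = (\<lambda>z::complex. K * exp (- (a / 2) * (cmod z)\<^sup>2))"
  have "integrable (power_sum_measure d) g"
  proof (cases "d = 2")
    case True
    then show ?thesis
      using integrable_gaussian_euclidean[of "a / 2", where 'a = complex] assms
      by (simp add: power_sum_measure_def g_def)
  next
    case False
    have "integrable lborel (\<lambda>x::real. g (complex_of_real x))"
      using integrable_gaussian_real[of "a / 2"] assms by (simp add: g_def)
    then show ?thesis
      using False by (simp add: power_sum_measure_def g_def integrable_distr_eq)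
  qed
  then show ?thesis
  proof (rule Bochner_Integration.integrable_bound)
    show "AE z in power_sum_measure d. norm (exp (- a * (cmod z)\<^sup>2 + Re (c * z))) \<le> norm (g z)"
    proof (rule AE_I2)
      fix z
      have "0 \<le> (cmod c - a * cmod z)\<^sup>2 / (2 * a)" using assms by simp
      also have "\<dots> = (cmod c)\<^sup>2 / (2 * a) - cmod c * cmod z + (a / 2) * (cmod z)\<^sup>2"
        using assms by (simp add: power2_diff field_simps power2_eq_square)
      finally have "cmod (c * z) \<le> (cmod c)\<^sup>2 / (2 * a) + (a / 2) * (cmod z)\<^sup>2"
        by (simp add: norm_mult)
      then have "- a * (cmod z)\<^sup>2 + Re (c * z) \<le> (cmod c)\<^sup>2 / (2 * a) + - (a / 2) * (cmod z)\<^sup>2"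
        using complex_Re_le_cmod[of "c * z"] by simp
      then have "exp (- a * (cmod z)\<^sup>2 + Re (c * z)) \<le> g z"
        by (simp add: g_def K_def exp_add[symmetric])
      then show "norm (exp (- a * (cmod z)\<^sup>2 + Re (c * z))) \<le> norm (g z)" by simp
    qed
  qed measurable
qed

interpretation power_sums: product_sigma_finite "\<lambda>i. power_sum_measure (d i)" for d :: "nat \<Rightarrow> nat"
  by (simp add: product_sigma_finite_def sigma_finite_power_sum_measure)

lemma integrable_product_gaussian:
  fixes a :: "nat \<Rightarrow> real" and c :: "nat \<Rightarrow> complex"
  assumes "\<And>i. i < N \<Longrightarrow> 0 < a i"
  shows "integrable (PiM {..<N} (\<lambda>i. power_sum_measure (d i)))
    (\<lambda>p. exp (\<Sum>i<N. - a i * (cmod (p i))\<^sup>2 + Re (c i * p i)))"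
  unfolding exp_sum[OF finite_lessThan]
  by (intro power_sums.product_integrable_prod integrable_power_sum_gaussian) (use assms in auto)

lemma PiM_power_sum_translate:
  fixes N :: nat and d :: "nat \<Rightarrow> nat" and t :: "nat \<Rightarrow> real"
  defines "M \<equiv> PiM {..<N} (\<lambda>i. power_sum_measure (d i))"
  shows "distr M M (\<lambda>p. \<lambda>i\<in>{..<N}. of_real (t i) + p i) = M"
  unfolding M_def
proof (rule power_sums.PiM_eqI)
  let ?M = "PiM {..<N} (\<lambda>i. power_sum_measure (d i))"
  let ?T = "\<lambda>p. \<lambda>i\<in>{..<N}. of_real (t i) + p i :: complex"
  have T: "?T \<in> measurable ?M ?M" by measurable
  fix A :: "nat \<Rightarrow> complex set"
  assume A: "\<And>i. i \<in> {..<N} \<Longrightarrow> A i \<in> sets (power_sum_measure (d i))"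
  let ?B = "\<lambda>i. (\<lambda>z. of_real (t i) + z) -` A i"
  have B: "?B i \<in> sets borel" if "i < N" for i
  proof -
    have "(\<lambda>z. of_real (t i) + z) \<in> measurable borel (borel :: complex measure)" by measurable
    from measurable_sets[OF this] show ?thesis using A that by simp
  qed
  have "emeasure (distr ?M ?M ?T) (Pi\<^sub>E {..<N} A) = emeasure ?M (?T -` (Pi\<^sub>E {..<N} A) \<inter> space ?M)"
    using A by (intro emeasure_distr T sets_PiM_I_finite) auto
  also have "?T -` (Pi\<^sub>E {..<N} A) \<inter> space ?M = Pi\<^sub>E {..<N} ?B"
    by (auto simp: space_PiM PiE_iff)
  also have "emeasure ?M (Pi\<^sub>E {..<N} ?B) = (\<Prod>i<N. emeasure (power_sum_measure (d i)) (?B i))"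
    using B by (intro power_sums.emeasure_PiM) auto
  also have "\<dots> = (\<Prod>i<N. emeasure (power_sum_measure (d i)) (A i))"
  proof (intro prod.cong refl)
    fix i assume i: "i \<in> {..<N}"
    have "emeasure (distr (power_sum_measure (d i)) borel (\<lambda>z. of_real (t i) + z)) (A i) =
        emeasure (power_sum_measure (d i)) (?B i)"
      using A[OF i] by (subst emeasure_distr) auto
    then show "emeasure (power_sum_measure (d i)) (?B i) = emeasure (power_sum_measure (d i)) (A i)"
      by (simp add: power_sum_measure_translate)
  qed
  finally show "emeasure (distr ?M ?M ?T) (Pi\<^sub>E {..<N} A) =
      (\<Prod>i<N. emeasure (power_sum_measure (d i)) (A i))" .
qed auto

text \<open>If \<open>f = exp H\<close> were integrable, its mass in the slab \<open>\<bar>Re (p 0) - t v\<^sub>0\<bar> \<le> R\<close> would tend to 0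
  as \<open>t \<longlongrightarrow> \<plusminus>\<infinity>\<close>; but the midpoint inequality bounds the sum of the masses at \<open>\<plusminus>t\<close> from below by
  twice the mass at 0.\<close>

lemma not_integrable_exp_midpoint:
  fixes N :: nat and H :: "(nat \<Rightarrow> complex) \<Rightarrow> real" and d :: "nat \<Rightarrow> nat" and v :: "nat \<Rightarrow> real"
  defines "M \<equiv> PiM {..<N} (\<lambda>i. power_sum_measure (d i))"
  assumes N: "0 < N" and v: "0 < v 0"
    and midpoint: "\<And>p t. 2 * H p \<le>
      H (\<lambda>i\<in>{..<N}. of_real (t * v i) + p i) + H (\<lambda>i\<in>{..<N}. of_real (- t * v i) + p i)"
  shows "\<not> integrable M (\<lambda>p. exp (H p))"
proof
  define f where "f = (\<lambda>p. exp (H p))"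
  define T where "T = (\<lambda>t p. \<lambda>i\<in>{..<N}. of_real (t * v i) + p i :: complex)"
  assume "integrable M (\<lambda>p. exp (H p))"
  then have f: "integrable M f" by (simp add: f_def)
  then have [measurable]: "f \<in> borel_measurable M" by (rule borel_measurable_integrable)
  have p0 [measurable]: "(\<lambda>p. p 0) \<in> borel_measurable M"
    using measurable_component_singleton[of 0 "{..<N}" "\<lambda>i. power_sum_measure (d i)"] N
    by (simp add: M_def cong: measurable_cong_sets)
  have T [measurable]: "T t \<in> measurable M M" for t
    unfolding M_def T_def by measurable
  have invariant: "distr M M (T t) = M" for t
    unfolding M_def T_def by (rule PiM_power_sum_translate)
  \<comment> \<open>Confining the single coordinate 0 is enough: since \<open>v 0\<close> is
    positive, the moving slab eventually leaves every point behind.\<close>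
  define slab where "slab = (\<lambda>R t p. indicator {p. \<bar>Re (p 0) - t * v 0\<bar> \<le> R} p * f p)"
  have slab_measurable [measurable]: "slab R t \<in> borel_measurable M" for R t
    unfolding slab_def by measurable
  have f_pos: "0 < f p" for p by (simp add: f_def)
  have slab_le: "norm (slab R t p) \<le> f p" for R t p
    using f_pos[of p] by (simp add: slab_def indicator_def)
  have slab_int: "integrable M (slab R t)" for R t
    by (rule Bochner_Integration.integrable_bound[OF f slab_measurable]) (use slab_le f_pos in \<open>auto simp: less_imp_le\<close>)
  have slab_T: "slab R t (T t p) = indicator {p. \<bar>Re (p 0)\<bar> \<le> R} p * f (T t p)" for R t p
    using N by (simp add: slab_def T_def indicator_def)
  have slab_shift: "integrable M (\<lambda>p. slab R t (T t p))"
    "(\<integral>p. slab R t (T t p) \<partial>M) = (\<integral>p. slab R t p \<partial>M)" for R t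
    using integrable_distr_eq[OF T slab_measurable, of t R t] integral_distr[OF T slab_measurable, of t R t]
      slab_int[of R t] by (simp_all add: invariant)
  have lower: "2 * (\<integral>p. slab R 0 p \<partial>M) \<le> (\<integral>p. slab R t p \<partial>M) + (\<integral>p. slab R (- t) p \<partial>M)" for R t
  proof -
    have "2 * slab R 0 p \<le> slab R t (T t p) + slab R (- t) (T (- t) p)" for p
    proof -
      \<comment> \<open>The midpoint inequality for \<open>H\<close> passes to \<open>exp H\<close>
        by the inequality between geometric and arithmetic mean.\<close>
      have "2 * f p \<le> 2 * exp ((H (T t p) + H (T (- t) p)) / 2)"
        using midpoint[of p t] by (simp add: f_def T_def)
      also have "exp ((H (T t p) + H (T (- t) p)) / 2) = exp (H (T t p) / 2) * exp (H (T (- t) p) / 2)"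
        by (simp add: add_divide_distrib exp_add)
      also have "2 * (exp (H (T t p) / 2) * exp (H (T (- t) p) / 2)) \<le>
          (exp (H (T t p) / 2))\<^sup>2 + (exp (H (T (- t) p) / 2))\<^sup>2"
        using sum_squares_bound[of "exp (H (T t p) / 2)" "exp (H (T (- t) p) / 2)"] by (simp add: mult_ac)
      also have "\<dots> = f (T t p) + f (T (- t) p)"
        by (simp add: f_def power2_eq_square mult_exp_exp)
      finally show ?thesis
        unfolding slab_T using slab_T by (simp add: slab_def indicator_def)
    qed
    then have "(\<integral>p. 2 * slab R 0 p \<partial>M) \<le> (\<integral>p. slab R t (T t p) + slab R (- t) (T (- t) p) \<partial>M)"
      by (intro integral_mono) (auto intro!: slab_int slab_shift)
    also have "\<dots> = (\<integral>p. slab R t p \<partial>M) + (\<integral>p. slab R (- t) p \<partial>M)"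
      using slab_shift by simp
    finally show ?thesis by simp
  qed
  have escape: "(\<lambda>k::nat. \<integral>p. slab R (s * real k) p \<partial>M) \<longlonglongrightarrow> 0" if s: "s = 1 \<or> s = -1" for R s
  proof -
    have "(\<lambda>k::nat. \<integral>p. slab R (s * real k) p \<partial>M) \<longlonglongrightarrow> (\<integral>p. 0 \<partial>M)"
    proof (rule integral_dominated_convergence[OF _ _ f])
      show "AE p in M. (\<lambda>k. slab R (s * real k) p) \<longlonglongrightarrow> 0"
      proof (rule AE_I2)
        fix p :: "nat \<Rightarrow> complex"
        obtain k0 :: nat where k0: "(R + \<bar>Re (p 0)\<bar>) / v 0 < real k0" using reals_Archimedean2 by blast
        have "slab R (s * real k) p = 0" if "k0 \<le> k" for k
        proof -
          have "(R + \<bar>Re (p 0)\<bar>) / v 0 < real k" using k0 that by linarith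
          then have "R + \<bar>Re (p 0)\<bar> < real k * v 0" using v by (simp add: pos_divide_less_eq)
          moreover have "s * real k * v 0 = real k * v 0 \<or> s * real k * v 0 = - (real k * v 0)"
            using s by auto
          ultimately have "\<not> \<bar>Re (p 0) - s * real k * v 0\<bar> \<le> R" by linarith
          then show ?thesis by (simp add: slab_def)
        qed
        then show "(\<lambda>k. slab R (s * real k) p) \<longlonglongrightarrow> 0"
          by (intro tendsto_eventually) (auto simp: eventually_sequentially)
      qed
    qed (use slab_le in auto)
    then show ?thesis by simp
  qed
  have slab_null: "(\<integral>p. slab R 0 p \<partial>M) \<le> 0" for R
  proof -
    have "(\<lambda>k::nat. (\<integral>p. slab R (1 * real k) p \<partial>M) + (\<integral>p. slab R (- 1 * real k) p \<partial>M)) \<longlonglongrightarrow> 0 + 0"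
      by (intro tendsto_add escape) auto
    then have "2 * (\<integral>p. slab R 0 p \<partial>M) \<le> 0"
      using lower[of R] by (intro LIMSEQ_le_const[where X = "\<lambda>k::nat. (\<integral>p. slab R (1 * real k) p \<partial>M) + (\<integral>p. slab R (- 1 * real k) p \<partial>M)"]) auto
    then show ?thesis by simp
  qed
  have "AE p in M. slab (real R) 0 p = 0" for R :: nat
  proof -
    have "0 \<le> slab (real R) 0 p" for p using f_pos[of p] by (simp add: slab_def indicator_def)
    moreover from this have "(\<integral>p. slab (real R) 0 p \<partial>M) = 0"
      using slab_null[of "real R"] by (intro antisym integral_nonneg) auto
    ultimately show ?thesis
      using integral_nonneg_eq_0_iff_AE[OF slab_int] by auto
  qed
  \<comment> \<open>The slabs with \<open>R = 0, 1, 2, ...\<close> exhaust the space and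
    \<open>f\<close> is positive everywhere, so \<open>M\<close> would be the zero measure.\<close>
  then have "AE p in M. \<forall>R::nat. slab (real R) 0 p = 0" by (simp add: AE_all_countable)
  then have "AE p in M. False"
  proof (rule AE_mp, intro AE_I2 impI)
    fix p :: "nat \<Rightarrow> complex" assume null: "\<forall>R::nat. slab (real R) 0 p = 0"
    obtain R :: nat where "\<bar>Re (p 0)\<bar> \<le> real R" using real_arch_simple by blast
    then show False using null[rule_format, of R] f_pos[of p] by (simp add: slab_def)
  qed
  then obtain Z where "space M \<subseteq> Z" "emeasure M Z = 0" "Z \<in> sets M"
    by (auto elim!: AE_E)
  then have "emeasure M (space M) = 0" using emeasure_mono[of "space M" Z M] by simp
  moreover have "emeasure M (space M) = (\<Prod>i<N. emeasure (power_sum_measure (d i)) UNIV)"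
    unfolding M_def space_PiM space_power_sum_measure by (intro power_sums.emeasure_PiM) auto
  ultimately show False by (simp add: emeasure_power_sum_measure_UNIV)
qed

section \<open>The quadratic form of a mode\<close>

definition coupling :: "quiver \<Rightarrow> nat \<Rightarrow> nat \<Rightarrow> real" where
  "coupling Q i j = real_of_int (B_mat Q $$ (i, j))"

lemma coupling_eq:
  assumes "i < size_of Q" "j < size_of Q"
  shows "coupling Q i j = real (d_at Q i) * adj (alg Q) i j"
proof -
  have "B_mat Q $$ (i, j) = (\<Sum>k<size_of Q. (if i = k then int (d_at Q i) else 0) * adjacency (alg Q) $$ (k, j))"
    using assms by (simp add: B_mat_def D_mat_def scalar_prod_def lessThan_atLeast0)
  also have "\<dots> = (\<Sum>k<size_of Q. if i = k then int (d_at Q i) * adjacency (alg Q) $$ (k, j) else 0)"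
    by (intro sum.cong) auto
  also have "\<dots> = int (d_at Q i) * adjacency (alg Q) $$ (i, j)"
    using assms by simp
  finally show ?thesis by (simp add: coupling_def adj_def)
qed

lemma coupling_nonneg: "i < size_of Q \<Longrightarrow> j < size_of Q \<Longrightarrow> 0 \<le> coupling Q i j"
  by (simp add: coupling_eq adj_nonneg)

text \<open>On simply-laced diagrams all d_i agree. Otherwise the factor 2 of a short node balances
  the weight 2 that \<open>adj\<close> has in the opposite direction of the bond.\<close>

lemma coupling_sym:
  assumes "gauge_compatible Q" "i < size_of Q" "j < size_of Q"
  shows "coupling Q i j = coupling Q j i"
proof (cases "simply_laced (alg Q)")
  case True
  then have "d_at Q i = d_at Q j"
    using assms by (auto simp: gauge_compatible_def)
  then show ?thesis
    using simply_laced_adj_sym[OF True assms(2,3)] assms(2,3) by (simp add: coupling_eq)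
next
  case False
  then have "d_at Q i = (if short_node (alg Q) i then 2 else 1)"
    "d_at Q j = (if short_node (alg Q) j then 2 else 1)" "alg Q \<noteq> AffA 1"
    using assms by (auto simp: gauge_compatible_def)
  then show ?thesis
    using assms(2,3) by (auto simp: coupling_eq adj_eq adjacent_sym[of "alg Q" j i])
qed

lemma d_at_pos: "0 < d_at Q i"
  by (cases "gauge_at Q i") auto

definition quadratic_form :: "quiver \<Rightarrow> (nat \<Rightarrow> complex) \<Rightarrow> real" where
  "quadratic_form Q p = (\<Sum>i<size_of Q. \<Sum>j<size_of Q. coupling Q i j * inner (p i) (p j))"

definition weighted_norm :: "quiver \<Rightarrow> (nat \<Rightarrow> complex) \<Rightarrow> real" where
  "weighted_norm Q p = (\<Sum>i<size_of Q. real (d_at Q i) * (norm (p i))\<^sup>2)"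

lemma coupling_perron:
  assumes "perron_vector (alg Q) lam v" "i < size_of Q"
  shows "(\<Sum>j<size_of Q. coupling Q i j * v j) = lam * real (d_at Q i) * v i"
proof -
  have "(\<Sum>j<size_of Q. coupling Q i j * v j) = real (d_at Q i) * (\<Sum>j<size_of Q. adj (alg Q) i j * v j)"
    unfolding sum_distrib_left using assms(2) by (intro sum.cong) (auto simp: coupling_eq)
  then show ?thesis using assms by (simp add: perron_vector_def)
qed

lemma quadratic_form_le:
  assumes "gauge_compatible Q" "perron_vector (alg Q) lam v"
  shows "quadratic_form Q p \<le> lam * weighted_norm Q p"
  unfolding quadratic_form_def weighted_norm_def
proof (rule form_le_ground_state[where v = v])
  show "coupling Q i j = coupling Q j i" if "i < size_of Q" "j < size_of Q" for i j
    using coupling_sym[OF assms(1) that] .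
  show "0 < v i" if "i < size_of Q" for i using perron_vector_pos[OF assms(2) that] .
qed (auto simp: coupling_nonneg coupling_perron[OF assms(2)])

text \<open>The case of equality in \<open>quadratic_form_le\<close>, at a vector that is real at
  every node.\<close>

lemma quadratic_form_perron:
  assumes "perron_vector (alg Q) lam v"
  shows "quadratic_form Q (\<lambda>i. of_real (v i)) = lam * weighted_norm Q (\<lambda>i. of_real (v i))"
proof -
  have "quadratic_form Q (\<lambda>i. of_real (v i)) = (\<Sum>i<size_of Q. v i * (\<Sum>j<size_of Q. coupling Q i j * v j))"
    by (simp add: quadratic_form_def inner_complex_def sum_distrib_left mult_ac)
  also have "\<dots> = (\<Sum>i<size_of Q. v i * (lam * real (d_at Q i) * v i))"
    using coupling_perron[OF assms] by simp
  also have "\<dots> = lam * weighted_norm Q (\<lambda>i. of_real (v i))"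
    by (simp add: weighted_norm_def sum_distrib_left power2_eq_square mult_ac)
  finally show ?thesis .
qed

section \<open>The exponent of a mode as quadratic form plus source\<close>

lemma exponent_term_eq:
  fixes Q P V x m
  defines "X \<equiv> (\<Sum>i<size_of Q. of_nat (d_at Q i) * (of_real ((cmod (P i m))\<^sup>2) + of_int (S_at Q i) * P i (2 * m)))"
    and "flav \<equiv> (\<Sum>i<size_of Q. \<Sum>j<size_of Q. of_int (D_mat Q $$ (i, j)) * cnj (V i m) * P j m)"
    and "Y \<equiv> (\<Sum>i<size_of Q. \<Sum>j<size_of Q. of_int (B_mat Q $$ (i, j)) * cnj (P i m) * P j m)"
  shows "exponent_term Q V x P m =
    (of_real (z_V x m) - 1) / (2 * of_nat m) * X
    + of_real (z_H x m) / (2 * of_nat m) * (Y + (flav + cnj flav))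
    - of_real (z_V x m) / of_nat m * (\<Sum>i<size_of Q. of_nat (d_at Q i) - 1)"
proof -
  have chi: "(\<Sum>i<size_of Q. chi_adj Q P i m) = X / 2 - (\<Sum>i<size_of Q. of_nat (d_at Q i) - 1)"
    unfolding X_def sum_divide_distrib sum_subtractf[symmetric] by (simp add: chi_adj_def)
  have haar: "haar_term Q P m = - (X / (2 * of_nat m))"
    unfolding X_def sum_divide_distrib haar_term_def by simp
  show ?thesis
    unfolding exponent_term_def letter_term_def Let_def chi haar flav_def[symmetric] Y_def[symmetric]
    \<comment> \<open>For \<open>m = 0\<close> both sides vanish, since division by zero gives
      zero.\<close>
    by (cases "m = 0") (simp_all add: field_simps)
qed

text \<open>With only mode \<open>n\<close> switched on, the term of index \<open>m\<close> sees it
  at most through \<open>P i (2 * m)\<close>, hence linearly and only if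
  \<open>2 * m = n\<close>.\<close>

lemma lower_exponent_linear:
  assumes "m \<noteq> n"
  shows "\<exists>c. \<forall>p. exponent_term Q V x (mode_only n p) m - exponent_term Q V x (\<lambda>_ _. 0) m =
    (\<Sum>i<size_of Q. c i * p i)"
proof -
  define c where "c = (\<lambda>i. if 2 * m = n then (of_real (z_V x m) - 1) / (2 * of_nat m) *
    (of_nat (d_at Q i) * of_int (S_at Q i)) else (0 :: complex))"
  have "exponent_term Q V x (mode_only n p) m - exponent_term Q V x (\<lambda>_ _. 0) m =
      (\<Sum>i<size_of Q. c i * p i)" for p
    unfolding exponent_term_eq using assms
    by (cases "2 * m = n") (simp_all add: mode_only_def c_def sum_distrib_left mult_ac)
  then show ?thesis by blast
qed

text \<open>The signs S^i drop out because \<open>2 * n \<noteq> n\<close>. The flavour term and its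
  conjugate add up to twice a real part, which accounts for \<open>z_H x n / real n\<close> instead
  of half of it in \<open>c\<close>.\<close>

lemma top_exponent_real:
  assumes "1 \<le> n"
  shows "\<exists>c. \<forall>p. Re (exponent_term Q V x (mode_only n p) n - exponent_term Q V x (\<lambda>_ _. 0) n) =
    (z_H x n * quadratic_form Q p - (1 - z_V x n) * weighted_norm Q p) / (2 * real n) +
    Re (\<Sum>i<size_of Q. c i * p i)"
proof -
  define c where "c = (\<lambda>j. of_real (z_H x n / real n) *
    (\<Sum>i<size_of Q. of_int (D_mat Q $$ (i, j)) * cnj (V i n)))"
  have "Re (exponent_term Q V x (mode_only n p) n - exponent_term Q V x (\<lambda>_ _. 0) n) =
    (z_H x n * quadratic_form Q p - (1 - z_V x n) * weighted_norm Q p) / (2 * real n) +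
    Re (\<Sum>i<size_of Q. c i * p i)" for p
  proof -
    define flav where "flav = (\<Sum>i<size_of Q. \<Sum>j<size_of Q. of_int (D_mat Q $$ (i, j)) * cnj (V i n) * p j)"
    define Y where "Y = (\<Sum>i<size_of Q. \<Sum>j<size_of Q. of_int (B_mat Q $$ (i, j)) * cnj (p i) * p j)"
    have diff: "exponent_term Q V x (mode_only n p) n - exponent_term Q V x (\<lambda>_ _. 0) n =
        of_real ((z_V x n - 1) / (2 * real n)) * of_real (weighted_norm Q p)
        + of_real (z_H x n / (2 * real n)) * (Y + (flav + cnj flav))"
      unfolding exponent_term_eq using assms
      by (simp add: mode_only_def weighted_norm_def flav_def Y_def)
    have Y: "Re Y = quadratic_form Q p"
      by (simp add: Y_def quadratic_form_def coupling_def inner_complex_def algebra_simps)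
    have flav_swap: "flav = (\<Sum>j<size_of Q. (\<Sum>i<size_of Q. of_int (D_mat Q $$ (i, j)) * cnj (V i n)) * p j)"
      unfolding flav_def sum_distrib_right by (rule sum.swap)
    have "(\<Sum>i<size_of Q. c i * p i) = of_real (z_H x n / real n) * flav"
      unfolding flav_swap sum_distrib_left by (simp only: c_def mult.assoc)
    then have flav: "Re (\<Sum>i<size_of Q. c i * p i) = z_H x n / real n * Re flav"
      by simp
    show ?thesis
      unfolding diff flav using assms by (simp add: Y field_simps)
  qed
  then show ?thesis by blast
qed

lemma mode_exponent_real:
  assumes "1 \<le> n"
  shows "\<exists>c. \<forall>p. Re (mode_exponent Q V x n p) =
    (z_H x n * quadratic_form Q p - (1 - z_V x n) * weighted_norm Q p) / (2 * real n) +
    Re (\<Sum>i<size_of Q. c i * p i)"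
proof -
  have "\<forall>m. \<exists>c. m \<noteq> n \<longrightarrow> (\<forall>p. exponent_term Q V x (mode_only n p) m - exponent_term Q V x (\<lambda>_ _. 0) m =
      (\<Sum>i<size_of Q. c i * p i))"
    using lower_exponent_linear by blast
  then obtain c where c: "\<And>m p. m \<noteq> n \<Longrightarrow>
      exponent_term Q V x (mode_only n p) m - exponent_term Q V x (\<lambda>_ _. 0) m =
      (\<Sum>i<size_of Q. c m i * p i)"
    by metis
  obtain c' where c': "\<And>p. Re (exponent_term Q V x (mode_only n p) n - exponent_term Q V x (\<lambda>_ _. 0) n) =
    (z_H x n * quadratic_form Q p - (1 - z_V x n) * weighted_norm Q p) / (2 * real n) +
    Re (\<Sum>i<size_of Q. c' i * p i)"
    using top_exponent_real[OF assms] by metis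
  have "Re (mode_exponent Q V x n p) =
    (z_H x n * quadratic_form Q p - (1 - z_V x n) * weighted_norm Q p) / (2 * real n) +
    Re (\<Sum>i<size_of Q. ((\<Sum>m = 1..<n. c m i) + c' i) * p i)" for p
  proof -
    have "{1..n} = insert n {1..<n}" using assms by auto
    then have "mode_exponent Q V x n p = (exponent_term Q V x (mode_only n p) n - exponent_term Q V x (\<lambda>_ _. 0) n)
        + (\<Sum>m = 1..<n. \<Sum>i<size_of Q. c m i * p i)"
      unfolding mode_exponent_def using c by simp
    also have "(\<Sum>m = 1..<n. \<Sum>i<size_of Q. c m i * p i) = (\<Sum>i<size_of Q. (\<Sum>m = 1..<n. c m i) * p i)"
      unfolding sum_distrib_right by (rule sum.swap)
    finally show ?thesis
      by (simp add: c' distrib_right sum.distrib del: minus_complex.sel Re_sum)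
  qed
  then show ?thesis by (intro exI allI)
qed

lemma mode_measure_eq: "mode_measure Q = PiM {..<size_of Q} (\<lambda>i. power_sum_measure (d_at Q i))"
  by (simp add: mode_measure_def power_sum_measure_def)

lemma mode_exponent_measurable [measurable]: "mode_exponent Q V x n \<in> borel_measurable (mode_measure Q)"
proof -
  have [measurable]: "(\<lambda>p. p i) \<in> borel_measurable (mode_measure Q)" if "i \<in> {..<size_of Q}" for i
    using measurable_component_singleton[OF that, of "\<lambda>i. power_sum_measure (d_at Q i)"]
    by (simp add: mode_measure_eq cong: measurable_cong_sets)
  then have [measurable]: "(\<lambda>p. mode_only n p i m) \<in> borel_measurable (mode_measure Q)"
    if "i \<in> {..<size_of Q}" for i m
    using that by (cases "m = n") (simp_all add: mode_only_def)
  have cnj: "cnj \<in> borel_measurable borel"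
    by (intro borel_measurable_continuous_onI continuous_intros)
  have [measurable]: "(\<lambda>p. cnj (mode_only n p i m)) \<in> borel_measurable (mode_measure Q)"
    if "i \<in> {..<size_of Q}" for i m
    using that measurable_compose[OF _ cnj] by measurable
  have flav: "(\<lambda>p. cnj (\<Sum>i<size_of Q. \<Sum>j<size_of Q. of_int (D_mat Q $$ (i, j)) * cnj (V i m) * mode_only n p j m))
      \<in> borel_measurable (mode_measure Q)" for m
    by (rule measurable_compose[OF _ cnj]) measurable
  have [measurable]: "(\<lambda>p. exponent_term Q V x (mode_only n p) m) \<in> borel_measurable (mode_measure Q)" for m
    unfolding exponent_term_eq using flav by measurable
  show ?thesis
    unfolding mode_exponent_def[abs_def] by measurable
qed

lemma mode_integrand_measurable: "mode_integrand Q V x n \<in> borel_measurable (mode_measure Q)"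
  unfolding mode_integrand_def[abs_def] by measurable

text \<open>Integrability is absolute, so the phases produced by complex sources do not matter: |exp
  z| = exp (Re z), and the prefactor is a positive constant.\<close>

lemma mode_converges_iff_integrable_exp:
  assumes "1 \<le> n"
  shows "mode_converges Q V x n \<longleftrightarrow> integrable (mode_measure Q) (\<lambda>p. exp (Re (mode_exponent Q V x n p)))"
proof -
  define K where "K = (\<Prod>i<size_of Q. (real (d_at Q i) / (2 * pi * real n)) powr (real (d_at Q i) / 2))"
  have "0 < K" unfolding K_def using assms d_at_pos[of Q] by (intro prod_pos) auto
  then have "norm (mode_integrand Q V x n p) = K * exp (Re (mode_exponent Q V x n p))" for p
    by (simp add: mode_integrand_def norm_mult flip: K_def del: of_real_prod)
  then have "mode_converges Q V x n \<longleftrightarrow> integrable (mode_measure Q) (\<lambda>p. K * exp (Re (mode_exponent Q V x n p)))"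
    unfolding mode_converges_def using integrable_norm_iff[OF mode_integrand_measurable, of Q V x n] by simp
  then show ?thesis using \<open>0 < K\<close> by simp
qed

text \<open>Parallelogram law: the terms linear in \<open>t\<close> cancel between the opposite
  shifts.\<close>

lemma quadratic_form_translate:
  "quadratic_form Q (\<lambda>i\<in>{..<size_of Q}. of_real (t * v i) + p i) +
   quadratic_form Q (\<lambda>i\<in>{..<size_of Q}. of_real (- t * v i) + p i) =
   2 * quadratic_form Q p + 2 * t\<^sup>2 * quadratic_form Q (\<lambda>i. of_real (v i))"
proof -
  have "inner (of_real (t * a) + z) (of_real (t * b) + w) + inner (of_real (- t * a) + z) (of_real (- t * b) + w) =
      2 * inner z w + 2 * t\<^sup>2 * inner (complex_of_real a) (of_real b)" for a b :: real and z w :: complex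
    by (simp add: inner_complex_def algebra_simps power2_eq_square)
  then show ?thesis
    by (simp add: quadratic_form_def sum.distrib[symmetric] sum_distrib_left distrib_left[symmetric]
        mult.left_commute[of _ "coupling Q _ _"] del: of_real_mult of_real_minus of_real_add)
qed

lemma weighted_norm_translate:
  "weighted_norm Q (\<lambda>i\<in>{..<size_of Q}. of_real (t * v i) + p i) +
   weighted_norm Q (\<lambda>i\<in>{..<size_of Q}. of_real (- t * v i) + p i) =
   2 * weighted_norm Q p + 2 * t\<^sup>2 * weighted_norm Q (\<lambda>i. of_real (v i))"
proof -
  have "(cmod (of_real (t * a) + z))\<^sup>2 + (cmod (of_real (- t * a) + z))\<^sup>2 =
      2 * (cmod z)\<^sup>2 + 2 * t\<^sup>2 * (cmod (of_real a))\<^sup>2" for a :: real and z :: complex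
    by (simp add: cmod_power2) (simp add: algebra_simps power2_eq_square)
  then show ?thesis
    by (simp add: weighted_norm_def sum.distrib[symmetric] sum_distrib_left distrib_left[symmetric]
        mult.left_commute[of _ "real (d_at Q _)"] del: of_real_mult of_real_minus of_real_add norm_of_real)
qed

text \<open>The quadratic part of the exponent is at most
  \<open>- \<alpha> * weighted_norm Q p / (2 * real n)\<close>, with equality along
  \<open>v\<close>; nonnegativity of \<open>z_H\<close> lets the ground-state bound be multiplied by
  it. For positive \<alpha> this gives a dominating product Gaussian. For \<alpha> \<le> 0 the
  shifts by \<open>t * v\<close> and \<open>- t * v\<close> satisfy the midpoint inequality, also in
  the flat case \<alpha> = 0.\<close>

proposition mode_converges_iff:
  assumes Q: "valid (alg Q)" "gauge_compatible Q" and v: "perron_vector (alg Q) lam v"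
    and n: "1 \<le> n" and zH: "0 \<le> z_H x n"
  shows "mode_converges Q V x n \<longleftrightarrow> z_V x n + lam * z_H x n < 1"
proof -
  let ?N = "size_of Q"
  define \<alpha> where "\<alpha> = 1 - z_V x n - lam * z_H x n"
  define H where "H = (\<lambda>p. Re (mode_exponent Q V x n p))"
  obtain c where H: "\<And>p. H p =
      (z_H x n * quadratic_form Q p - (1 - z_V x n) * weighted_norm Q p) / (2 * real n) +
      Re (\<Sum>i<?N. c i * p i)"
    using mode_exponent_real[OF n, of Q V x] unfolding H_def by blast
  have conv: "mode_converges Q V x n \<longleftrightarrow> integrable (mode_measure Q) (\<lambda>p. exp (H p))"
    unfolding H_def by (rule mode_converges_iff_integrable_exp[OF n])
  have N: "0 < ?N" using num_nodes_pos[OF Q(1)] .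
  have "integrable (mode_measure Q) (\<lambda>p. exp (H p))" if \<alpha>: "0 < \<alpha>"
  proof -
    define a where "a = (\<lambda>i. \<alpha> * real (d_at Q i) / (2 * real n))"
    have "integrable (mode_measure Q) (\<lambda>p. exp (\<Sum>i<?N. - a i * (cmod (p i))\<^sup>2 + Re (c i * p i)))"
      unfolding mode_measure_eq
      by (rule integrable_product_gaussian) (use \<alpha> n d_at_pos in \<open>simp add: a_def\<close>)
    then show ?thesis
    proof (rule Bochner_Integration.integrable_bound)
      show "(\<lambda>p. exp (H p)) \<in> borel_measurable (mode_measure Q)" unfolding H_def by measurable
      show "AE p in mode_measure Q. norm (exp (H p)) \<le>
          norm (exp (\<Sum>i<?N. - a i * (cmod (p i))\<^sup>2 + Re (c i * p i)))"
      proof (rule AE_I2)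
        fix p
        have "z_H x n * quadratic_form Q p \<le> z_H x n * (lam * weighted_norm Q p)"
          using quadratic_form_le[OF Q(2) v] zH by (rule mult_left_mono)
        then have "z_H x n * quadratic_form Q p - (1 - z_V x n) * weighted_norm Q p \<le> - \<alpha> * weighted_norm Q p"
          by (simp add: \<alpha>_def algebra_simps)
        then have "H p \<le> - \<alpha> * weighted_norm Q p / (2 * real n) + Re (\<Sum>i<?N. c i * p i)"
          unfolding H using n by (intro add_right_mono divide_right_mono) auto
        also have "\<dots> = (\<Sum>i<?N. - a i * (cmod (p i))\<^sup>2 + Re (c i * p i))"
          unfolding weighted_norm_def sum_distrib_left sum_divide_distrib Re_sum sum.distrib[symmetric]
          by (simp add: a_def mult.assoc)
        finally show "norm (exp (H p)) \<le> norm (exp (\<Sum>i<?N. - a i * (cmod (p i))\<^sup>2 + Re (c i * p i)))"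
          by simp
      qed
    qed
  qed
  moreover have "\<not> integrable (mode_measure Q) (\<lambda>p. exp (H p))" if \<alpha>: "\<alpha> \<le> 0"
    unfolding mode_measure_eq
  proof (rule not_integrable_exp_midpoint[where v = v and H = H, OF N perron_vector_pos[OF v N]])
    fix p :: "nat \<Rightarrow> complex" and t :: real
    define T where "T = (\<lambda>s. \<lambda>i\<in>{..<?N}. of_real (s * v i) + p i)"
    have linear: "Re (\<Sum>i<?N. c i * T t i) + Re (\<Sum>i<?N. c i * T (- t) i) = 2 * Re (\<Sum>i<?N. c i * p i)"
    proof -
      have "(\<Sum>i<?N. c i * T t i) + (\<Sum>i<?N. c i * T (- t) i) = 2 * (\<Sum>i<?N. c i * p i)"
        by (simp add: T_def sum.distrib[symmetric] sum_distrib_left algebra_simps)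
      then show ?thesis by (metis Re_complex_of_real plus_complex.sel(1) mult_2)
    qed
    have nonneg: "0 \<le> weighted_norm Q (\<lambda>i. of_real (v i))"
      by (simp add: weighted_norm_def sum_nonneg)
    have quad: "quadratic_form Q (T t) + quadratic_form Q (T (- t)) =
        2 * quadratic_form Q p + 2 * t\<^sup>2 * (lam * weighted_norm Q (\<lambda>i. of_real (v i)))"
      unfolding T_def quadratic_form_translate quadratic_form_perron[OF v] ..
    have norm: "weighted_norm Q (T t) + weighted_norm Q (T (- t)) =
        2 * weighted_norm Q p + 2 * t\<^sup>2 * weighted_norm Q (\<lambda>i. of_real (v i))"
      unfolding T_def weighted_norm_translate ..
    have "H (T t) + H (T (- t)) =
        (z_H x n * (quadratic_form Q (T t) + quadratic_form Q (T (- t)))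
          - (1 - z_V x n) * (weighted_norm Q (T t) + weighted_norm Q (T (- t)))) / (2 * real n)
        + (Re (\<Sum>i<?N. c i * T t i) + Re (\<Sum>i<?N. c i * T (- t) i))"
      unfolding H by (simp add: algebra_simps add_divide_distrib diff_divide_distrib)
    also have "\<dots> = 2 * H p + - \<alpha> * t\<^sup>2 * weighted_norm Q (\<lambda>i. of_real (v i)) / real n"
      unfolding quad norm linear unfolding H \<alpha>_def using n
      by (simp add: field_simps)
    finally show "2 * H p \<le> H (\<lambda>i\<in>{..<?N}. of_real (t * v i) + p i) + H (\<lambda>i\<in>{..<?N}. of_real (- t * v i) + p i)"
      using \<alpha> nonneg unfolding T_def by (simp add: mult_nonpos_nonneg divide_nonpos_nonneg)
  qed
  ultimately show ?thesis
    unfolding conv \<alpha>_def by (cases "z_V x n + lam * z_H x n < 1") auto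
qed

section \<open>The Hagedorn point\<close>

lemma z_phi_pos: "0 < y \<Longrightarrow> y < 1 \<Longrightarrow> 0 < z_phi y"
  by (simp add: z_phi_def)

lemma z_psi_nonneg: "0 < y \<Longrightarrow> y < 1 \<Longrightarrow> 0 \<le> z_psi y"
  by (simp add: z_psi_def)

text \<open>The numerators of \<open>2 * z_phi y - z_psi y\<close> combine to
  \<open>2 * y * (1 - sqrt y)^2\<close>. This keeps \<open>z_H x n\<close> nonnegative for even
  \<open>n\<close>, where the fermions enter with a minus sign.\<close>

lemma z_psi_le: 
  assumes "0 < y" "y < 1"
  shows "z_psi y \<le> 2 * z_phi y"
proof -
  have "y powr (3/2) = y powr (1 + 1/2)" by simp
  also have "\<dots> = y * sqrt y" using assms by (simp only: powr_add) (simp add: powr_half_sqrt)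
  finally have "2 * (y * (1 + y)) - 4 * y powr (3/2) = 2 * y * (1 - sqrt y)\<^sup>2"
    using assms by (simp add: power2_diff algebra_simps)
  also have "\<dots> \<ge> 0" using assms by simp
  finally have "4 * y powr (3/2) \<le> 2 * (y * (1 + y))" by simp
  then have "4 * y powr (3/2) / (1 - y) ^ 3 \<le> 2 * (y * (1 + y)) / (1 - y) ^ 3"
    using assms by (intro divide_right_mono) simp_all
  then show ?thesis by (simp add: z_psi_def z_phi_def)
qed

lemma minus_one_power_cases: "(-1 :: real) ^ k = 1 \<or> (-1 :: real) ^ k = -1"
  by (cases "even k") auto

lemma z_H_nonneg:
  assumes "0 < x" "x < 1" "1 \<le> n"
  shows "0 \<le> z_H x n"
proof -
  have y: "0 < x ^ n" "x ^ n < 1" using assms by (auto simp: power_less_one_iff)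
  show ?thesis
    using minus_one_power_cases[of "n + 1"] z_psi_le[OF y] z_psi_nonneg[OF y] z_phi_pos[OF y]
    by (auto simp: z_H_def)
qed

definition growth :: "real \<Rightarrow> real \<Rightarrow> real" where
  "growth lam x = z_V x 1 + lam * z_H x 1"

lemma growth_eq: "growth lam x = z_A x + (2 + 2 * lam) * z_phi x + (2 + lam) * z_psi x"
  by (simp add: growth_def z_V_def z_H_def algebra_simps)

text \<open>The two sides differ only in the sign of the fermionic contribution, which is
  nonnegative when counted positively.\<close>

lemma higher_mode_le_growth:
  assumes "0 < x" "x < 1" "1 \<le> n" "0 \<le> lam"
  shows "z_V x n + lam * z_H x n \<le> growth lam (x ^ n)"
proof -
  have y: "0 < x ^ n" "x ^ n < 1" using assms by (auto simp: power_less_one_iff)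
  have "(-1) ^ (n + 1) * ((2 + lam) * z_psi (x ^ n)) \<le> (2 + lam) * z_psi (x ^ n)"
    using minus_one_power_cases[of "n + 1"] z_psi_nonneg[OF y] assms(4)
    by (auto intro: mult_nonneg_nonneg)
  then show ?thesis by (simp add: growth_eq z_V_def z_H_def algebra_simps)
qed

text \<open>In each single-letter function the numerator grows and the denominator shrinks.
  Strictness comes from \<open>z_phi\<close>, whose coefficient \<open>2 + 2 * lam\<close> is
  positive.\<close>

lemma growth_strict_mono:
  assumes "0 < x" "x < y" "y < 1" "0 \<le> lam"
  shows "growth lam x < growth lam y"
proof -
  have den: "(1 - y) ^ 3 \<le> (1 - x) ^ 3" "0 < (1 - y) ^ 3"
    using assms by (auto intro: power_mono)
  have phi: "z_phi x < z_phi y"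
    unfolding z_phi_def using assms den
    by (intro frac_less mult_strict_mono) auto
  have psi: "z_psi x \<le> z_psi y"
    unfolding z_psi_def using assms den
    by (intro frac_le mult_left_mono powr_mono2) auto
  have num: "6 * u\<^sup>2 - 2 * u ^ 3 = 2 * (u * u) * (3 - u)" for u :: real
    by (simp add: algebra_simps power2_eq_square power3_eq_cube)
  \<comment> \<open>The last factor is 3 (x + y) - (x^2 + x y + y^2), regrouped into terms that are
    visibly nonnegative on the unit interval.\<close>
  have "6 * y\<^sup>2 - 2 * y ^ 3 - (6 * x\<^sup>2 - 2 * x ^ 3) =
      2 * (y - x) * (x * (1 - x) + y * (1 - y) + x * (1 - y) + x + 2 * y)"
    by (simp add: algebra_simps power2_eq_square power3_eq_cube)
  moreover have "0 \<le> 2 * (y - x) * (x * (1 - x) + y * (1 - y) + x * (1 - y) + x + 2 * y)"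
    using assms by (intro mult_nonneg_nonneg add_nonneg_nonneg) auto
  ultimately have "6 * x\<^sup>2 - 2 * x ^ 3 \<le> 6 * y\<^sup>2 - 2 * y ^ 3" by linarith
  moreover have "0 \<le> 6 * x\<^sup>2 - 2 * x ^ 3" unfolding num using assms by simp
  ultimately have "z_A x \<le> z_A y"
    unfolding z_A_def using den by (intro frac_le) auto
  moreover have "(2 + 2 * lam) * z_phi x < (2 + 2 * lam) * z_phi y"
    using phi assms(4) by (intro mult_strict_left_mono) auto
  moreover have "(2 + lam) * z_psi x \<le> (2 + lam) * z_psi y"
    using psi assms(4) by (intro mult_left_mono) auto
  ultimately show ?thesis by (simp add: growth_eq)
qed

lemma growth_threshold:
  assumes "0 \<le> lam"
  obtains x0 where "0 < x0" "x0 < 1" "growth lam x0 = 1"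
    and "\<And>x. 0 < x \<Longrightarrow> x < 1 \<Longrightarrow> 1 \<le> growth lam x \<longleftrightarrow> x0 \<le> x"
    and "\<And>x. 0 < x \<Longrightarrow> x < 1 \<Longrightarrow> growth lam x = 1 \<longleftrightarrow> x = x0"
proof -
  have powr: "continuous_on {0..1/2} (\<lambda>x::real. x powr (3/2))"
    by (rule continuous_on_powr') auto
  then have cont: "continuous_on {0..1/2} (growth lam)"
    unfolding growth_eq[abs_def] z_A_def z_phi_def z_psi_def
    by (intro continuous_on_add continuous_on_diff continuous_on_mult continuous_on_divide
        continuous_on_power continuous_on_const continuous_on_id powr) auto
  have "growth lam 0 = 0" by (simp add: growth_eq z_A_def z_phi_def z_psi_def)
  \<comment> \<open>Stopping at 1/2 avoids the pole at 1, and already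
    \<open>z_A (1/2) = 10\<close>.\<close>
  moreover have "1 \<le> growth lam (1/2)"
  proof -
    have "1 \<le> z_A (1/2)" by (simp add: z_A_def power2_eq_square power3_eq_cube)
    moreover have "0 \<le> (2 + 2 * lam) * z_phi (1/2)" "0 \<le> (2 + lam) * z_psi (1/2)"
      using z_phi_pos[of "1/2"] z_psi_nonneg[of "1/2"] assms by auto
    ultimately show ?thesis by (simp add: growth_eq)
  qed
  ultimately obtain x0 where x0: "0 \<le> x0" "x0 \<le> 1/2" "growth lam x0 = 1"
    using IVT'[of "growth lam" 0 1 "1/2"] cont by auto
  moreover have "x0 \<noteq> 0" using x0(3) \<open>growth lam 0 = 0\<close> by auto
  ultimately have pos: "0 < x0" "x0 < 1" by auto
  show ?thesis
  proof (rule that[OF pos x0(3)])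
    fix x :: real assume x: "0 < x" "x < 1"
    note mono = growth_strict_mono[of x x0 lam] growth_strict_mono[of x0 x lam]
    show "1 \<le> growth lam x \<longleftrightarrow> x0 \<le> x"
      using mono x pos x0(3) assms by (cases x x0 rule: linorder_cases) auto
    show "growth lam x = 1 \<longleftrightarrow> x = x0"
      using mono x pos x0(3) assms by (cases x x0 rule: linorder_cases) auto
  qed
qed

section \<open>The smallest divergent point and the temperature\<close>

lemma perron_vector_value_nonneg:
  assumes "perron_vector b lam v" "valid b"
  shows "0 \<le> lam"
proof -
  have N: "0 < num_nodes b" using num_nodes_pos[OF assms(2)] .
  have "0 \<le> (\<Sum>j < num_nodes b. adj b 0 j * v j)"
    using N perron_vector_pos[OF assms(1)] by (intro sum_nonneg mult_nonneg_nonneg) (auto simp: adj_nonneg less_imp_le)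
  also have "\<dots> = lam * v 0" using assms(1) N by (simp add: perron_vector_def)
  finally show ?thesis using perron_vector_pos[OF assms(1) N] by (simp add: zero_le_mult_iff)
qed

text \<open>Divergence of mode \<open>n\<close> at \<open>y\<close> gives
  \<open>x0 \<le> y ^ n \<le> y\<close>, so the divergent points are exactly
  \<open>{x0..<1}\<close>. The left end belongs to the set because a vanishing gap already destroys
  convergence.\<close>

lemma hagedorn_point_iff:
  assumes Q: "valid (alg Q)" "gauge_compatible Q" and v: "perron_vector (alg Q) lam v"
    and x0: "0 < x0" "x0 < 1"
    and threshold: "\<And>x. 0 < x \<Longrightarrow> x < 1 \<Longrightarrow> 1 \<le> growth lam x \<longleftrightarrow> x0 \<le> x"
  shows "hagedorn_point Q V x \<longleftrightarrow> x = x0"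
proof -
  have lam: "0 \<le> lam" using perron_vector_value_nonneg[OF v Q(1)] .
  have converges: "mode_converges Q V y n \<longleftrightarrow> z_V y n + lam * z_H y n < 1"
    if "0 < y" "y < 1" "1 \<le> n" for y n
    using mode_converges_iff[OF Q v that(3)] z_H_nonneg[OF that] .
  have diverges: "(\<exists>n \<ge> 1. \<not> mode_converges Q V y n) \<longleftrightarrow> x0 \<le> y" if y: "0 < y" "y < 1" for y
  proof
    assume "\<exists>n \<ge> 1. \<not> mode_converges Q V y n"
    then obtain n where n: "1 \<le> n" "1 \<le> z_V y n + lam * z_H y n"
      using converges[OF y] by force
    have "0 < y ^ n" "y ^ n < 1" using y n(1) by (auto simp: power_less_one_iff)
    moreover have "1 \<le> growth lam (y ^ n)"
      using n(2) higher_mode_le_growth[OF y n(1) lam] by linarith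
    ultimately have "x0 \<le> y ^ n" using threshold by blast
    also have "y ^ n \<le> y" using power_decreasing[of 1 n y] y n(1) by simp
    finally show "x0 \<le> y" .
  next
    assume "x0 \<le> y"
    then have "1 \<le> growth lam y" using threshold[OF y] by blast
    then have "\<not> mode_converges Q V y 1" using converges[OF y, of 1] by (simp add: growth_def)
    then show "\<exists>n \<ge> 1. \<not> mode_converges Q V y n" by blast
  qed
  have "0 < y \<and> y < 1 \<and> (\<exists>n \<ge> 1. \<not> mode_converges Q V y n) \<longleftrightarrow> x0 \<le> y \<and> y < 1" for y
    using diverges[of y] x0(1) by (metis less_le_trans)
  then have set: "{y. 0 < y \<and> y < 1 \<and> (\<exists>n \<ge> 1. \<not> mode_converges Q V y n)} = {x0..<1}"
    by (simp only: set_eq_iff mem_Collect_eq atLeastLessThan_iff simp_thms)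
  have x0_mem: "x0 \<in> {x0..<1}" using x0(2) by simp
  show ?thesis unfolding hagedorn_point_def set smallest_in_def
  proof
    assume "x \<in> {x0..<1} \<and> (\<forall>y \<in> {x0..<1}. x \<le> y)"
    then have "x0 \<le> x" "x \<le> x0" using x0_mem by simp_all
    then show "x = x0" by simp
  next
    assume "x = x0"
    then show "x \<in> {x0..<1} \<and> (\<forall>y \<in> {x0..<1}. x \<le> y)" using x0_mem by simp
  qed
qed

lemma exp_minus_inverse_eq_iff:
  fixes x T :: real
  assumes "0 < x" "x < 1"
  shows "0 < T \<and> exp (- 1 / T) = x \<longleftrightarrow> T = - 1 / ln x"
proof -
  have ln: "ln x < 0" using assms by simp
  show ?thesis
  proof
    assume T: "0 < T \<and> exp (- 1 / T) = x"
    then have "ln x = - 1 / T" by auto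
    then show "T = - 1 / ln x" using T by simp
  next
    assume "T = - 1 / ln x"
    then have "- 1 / T = ln x" "0 < T" using ln by (simp_all add: divide_neg_neg)
    then show "0 < T \<and> exp (- 1 / T) = x" using assms(1) by simp
  qed
qed

theorem mainTheorem1:
  fixes Q :: quiver and V :: "nat \<Rightarrow> nat \<Rightarrow> complex"
  assumes "quiver_scft Q"
  shows "(\<exists>U. unfolds_to (alg Q) U) \<and>
    (\<forall>U. unfolds_to (alg Q) U \<longrightarrow>
      (let lam = (if is_affine U then 2 else 2 * cos (pi / real (dual_coxeter U)))
       in eigenvalue (map_mat real_of_int (adjacency U)) lam \<and>
          (\<forall>\<mu>. eigenvalue (map_mat real_of_int (adjacency U)) \<mu> \<longrightarrow> \<mu> \<le> lam) \<and>
          (\<exists>!T. hagedorn_temperature Q V T) \<and>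
          (\<forall>T. hagedorn_temperature Q V T \<longleftrightarrow>
             0 < T \<and>
             smallest_in {x. 0 < x \<and> x < 1 \<and> 1 - z_V x 1 = lam * z_H x 1} (exp (- 1 / T)))))"
proof (intro conjI allI impI)
  have Q: "valid (alg Q)" "gauge_compatible Q" using assms by (auto simp: quiver_scft_def)
  show "\<exists>U. unfolds_to (alg Q) U" using unfolds_to_exists[OF Q(1)] .
  fix U assume unfold: "unfolds_to (alg Q) U"
  then have U: "valid U" "simply_laced U" by (auto simp: unfolds_to_def)
  define lam where "lam = (if is_affine U then 2 else 2 * cos (pi / real (dual_coxeter U)))"
  obtain w where w: "perron_vector U lam w"
    using perron_vector_lambda_max[OF U] by (auto simp: lam_def lambda_max_def)
  obtain v where v: "perron_vector (alg Q) lam v"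
    using perron_vector_fold[OF unfold Q(1) w] by blast
  obtain x0 where x0: "0 < x0" "x0 < 1" "growth lam x0 = 1"
    and threshold: "\<And>x. 0 < x \<Longrightarrow> x < 1 \<Longrightarrow> 1 \<le> growth lam x \<longleftrightarrow> x0 \<le> x"
    and root: "\<And>x. 0 < x \<Longrightarrow> x < 1 \<Longrightarrow> growth lam x = 1 \<longleftrightarrow> x = x0"
    using growth_threshold[OF perron_vector_value_nonneg[OF w U(1)]] by metis
  have point: "hagedorn_point Q V x \<longleftrightarrow> x = x0" for x
    using hagedorn_point_iff[OF Q v x0(1,2)] threshold by blast
  have temperature: "hagedorn_temperature Q V T \<longleftrightarrow> T = - 1 / ln x0" for T
    unfolding hagedorn_temperature_def point
    by (rule exp_minus_inverse_eq_iff[OF x0(1,2)])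
  \<comment> \<open>By strict monotonicity the equation has a single solution in the unit interval,
    so "smallest" selects it without competition.\<close>
  have "1 - z_V x 1 = lam * z_H x 1 \<longleftrightarrow> growth lam x = 1" for x
    by (auto simp: growth_def)
  then have "{x. 0 < x \<and> x < 1 \<and> 1 - z_V x 1 = lam * z_H x 1} = {x0}"
    using root x0(1,2) by auto
  then have smallest: "smallest_in {x. 0 < x \<and> x < 1 \<and> 1 - z_V x 1 = lam * z_H x 1} x \<longleftrightarrow> x = x0" for x
    by (auto simp: smallest_in_def)
  show "let lam = (if is_affine U then 2 else 2 * cos (pi / real (dual_coxeter U)))
       in eigenvalue (map_mat real_of_int (adjacency U)) lam \<and>
          (\<forall>\<mu>. eigenvalue (map_mat real_of_int (adjacency U)) \<mu> \<longrightarrow> \<mu> \<le> lam) \<and>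
          (\<exists>!T. hagedorn_temperature Q V T) \<and>
          (\<forall>T. hagedorn_temperature Q V T \<longleftrightarrow>
             0 < T \<and>
             smallest_in {x. 0 < x \<and> x < 1 \<and> 1 - z_V x 1 = lam * z_H x 1} (exp (- 1 / T)))"
    unfolding Let_def lam_def[symmetric] smallest temperature exp_minus_inverse_eq_iff[OF x0(1,2)]
    using perron_vector_eigenvalue[OF w U(1)] perron_vector_eigenvalue_le[OF w U(2)] by blast
qed

end
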